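(* In the call-by-value $\lambda$-calculus with callcc, abort and context variables, the set $\mathcal F=\{\mathrm{refl},\mathrm{result},\mathrm{abort},\mathrm{lam},\mathrm{substv},\mathrm{substc},\mathrm{red}\}$ of functions on relations on programs is diacritically compatible, and $\mathrm{strong}(\mathcal F)=\mathcal F\setminus\{\mathrm{substc}\}$.
   Context: Syntax: variables $x,y,z$; context variables $k$ (a separate set). Terms $t,s::=x\mid\lambda x.t\mid t\,s\mid\mathcal C\mid\mathcal A\,p$; values $v,w::=x\mid\lambda x.t\mid\mathcal C$ ($\mathcal C$ is callcc, $\mathcal A$ is abort); programs $p,q::=t\mid k\,t$; evaluation contexts $E::=[\,]\mid v\,E\mid E\,t$; program contexts $F::=E\mid k\,E$; $F[t]$ is plugging. Terms modulo $\alpha$-conversion, $p\{v/x\}$ capture-avoiding substitution. Reduction on programs: $F[(\lambda x.t)\,v]\to F[t\{v/x\}]$; $F[\mathcal C\,v]\to F[v\,(\lambda y.\mathcal A\,F[y])]$ with $y$ not free in $F$; $F[\mathcal A\,p]\to p$. $\to^*$ is the reflexive-transitive closure; $p\Downarrow q$ means $p\to^*q$ with $q$ irreducible. Context substitution $p\{F/k\}$: $(k\,t)\{F/k\}=F[t\{F/k\}]$; $(k'\,t)\{F/k\}=k'\,(t\{F/k\})$ for $k'\neq k$; applied recursively to subterms and subprograms otherwise. A (context) variable is fresh if it does not occur in the objects under consideration. For a relation $R$ on programs: $t\mathrel{R^t}s$ iff $(k\,t)\mathrel R(k\,s)$ for fresh $k$; $v\mathrel{R^v}w$ iff $(v\,x)\mathrel{R^t}(w\,x)$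 for fresh $x$; $F\mathrel{R^E}F'$ iff $F[x]\mathrel RF'[x]$ for fresh $x$; $F[x\,v]\mathrel{R^o}F'[x\,w]$ iff $F\mathrel{R^E}F'$ and $v\mathrel{R^v}w$. Diacritical progress: $R\rightsquigarrow S,T$ iff $R\subseteq S\subseteq T$ and whenever $p\mathrel Rq$: (i) if $p\to p'$ then $q\to^*q'$ with $p'\mathrel Tq'$; (ii) if $p$ is a value $v$ then $q\Downarrow w$ for some value $w$; (iii) if $p=F[x\,v]$ then $q\Downarrow F'[x\,w]$ with $F[x\,v]\mathrel{T^o}F'[x\,w]$; (iv) if $p=k\,v$ then $q\Downarrow k\,w$ for some value $w$ with $v\mathrel{S^v}w$; (v) the symmetric conditions with $p,q$ exchanged. Functions on relations: $\mathrm{id}(R)=R$; $(f\cup g)(R)=f(R)\cup g(R)$; $(f\circ g)(R)=f(g(R))$; $f^\omega=\bigcup_{n\in\mathbb N}f^n$ ($f^0=\mathrm{id}$); $\hat f=f\cup\mathrm{id}$; a set $\mathcal G$ of functions is identified with $\bigcup_{f\in\mathcal G}f$. $f$ is continuous if $f(R)\subseteq\bigcup\{f(S)\mid S\subseteq R\text{ finite}\}$. $f$ evolves to $g,h$ if for all $R,T$ with $R\rightsquigarrow R,T$, $f(R)\rightsquigarrow g(R),h(T)$; $f$ strongly evolves to $g,h$ if for all $R,S,T$ with $R\rightsquigarrow S,T$, $f(R)\rightsquigarrow g(S),h(T)$. A set $\mathcal F$ of continuous functions is diacritically compatible if it has a subset $\mathcal S$ such that every $f\in\mathcal S$ strongly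 evolves to $\hat{\mathcal S}^\omega,\hat{\mathcal F}^\omega$ and every $f\in\mathcal F$ evolves to $\hat{\mathcal S}^\omega\circ\hat{\mathcal F}\circ\hat{\mathcal S}^\omega,\hat{\mathcal F}^\omega$; the union of all such subsets is again such a subset and is denoted $\mathrm{strong}(\mathcal F)$. Specific functions: $\mathrm{refl}(R)=\{(p,p)\}$; $\mathrm{result}(R)=\{(v,w)\mid v,w\text{ values}\}$; $\mathrm{abort}(R)=\{(k\,(\mathcal A\,p),k\,(\mathcal A\,q))\mid p\mathrel Rq\}$; $\mathrm{lam}(R)=\{(k\,(\lambda x.t),k\,(\lambda x.s))\mid t\mathrel{R^t}s\}$; $\mathrm{substv}(R)=\{(p\{v/x\},q\{w/x\})\mid p\mathrel Rq,\ v\mathrel{R^v}w\}$; $\mathrm{substc}(R)=\{(p\{F/k\},q\{F'/k\})\mid p\mathrel Rq,\ F\mathrel{R^E}F'\}$; $\mathrm{red}(R)=\{(p,q)\mid p\to^*p',q\to^*q',p'\mathrel Rq'\}$. *)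

theory Defs
  imports Main
begin

text \<open>
  Terms modulo alpha-conversion are represented with de Bruijn indices.  A term may be open: under
  \<open>d\<close> binders, index \<open>n + d\<close> denotes the free variable with name \<open>n\<close>, so the (countably many)
  variables are the natural numbers.  Context variables are never bound by the syntax and are plain
  names.  Values form a syntactic category of their own, embedded into terms by \<open>Val\<close>; terms are
  embedded into programs by \<open>Trm\<close>, and \<open>Nam k t\<close> is the program \<open>k t\<close>.
\<close>

datatype val = Var nat | Lam trm | Callcc
  and trm = Val val | App trm trm | Abort prog
  and prog = Trm trm | Nam nat trm

text \<open>\<open>ArgC v E\<close> is \<open>v E\<close> and \<open>FunC E t\<close> is \<open>E t\<close>.\<close>

datatype ectx = Hole | ArgC val ectx | FunC ectx trm

datatype pctx = PlainC ectx | NamC nat ectx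

primrec eplug :: "ectx \<Rightarrow> trm \<Rightarrow> trm" where
  "eplug Hole t = t"
| "eplug (ArgC v E) t = App (Val v) (eplug E t)"
| "eplug (FunC E s) t = App (eplug E t) s"

primrec plug :: "pctx \<Rightarrow> trm \<Rightarrow> prog" where
  "plug (PlainC E) t = Trm (eplug E t)"
| "plug (NamC k E) t = Nam k (eplug E t)"


subsection \<open>Free variables and context variables\<close>

primrec fv_val :: "val \<Rightarrow> nat set" and fv_trm :: "trm \<Rightarrow> nat set" and fv_prog :: "prog \<Rightarrow> nat set" where
  "fv_val (Var n) = {n}"
| "fv_val (Lam t) = {n. Suc n \<in> fv_trm t}"
| "fv_val Callcc = {}"
| "fv_trm (Val v) = fv_val v"
| "fv_trm (App t s) = fv_trm t \<union> fv_trm s"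
| "fv_trm (Abort p) = fv_prog p"
| "fv_prog (Trm t) = fv_trm t"
| "fv_prog (Nam k t) = fv_trm t"

primrec fv_ectx :: "ectx \<Rightarrow> nat set" where
  "fv_ectx Hole = {}"
| "fv_ectx (ArgC v E) = fv_val v \<union> fv_ectx E"
| "fv_ectx (FunC E t) = fv_ectx E \<union> fv_trm t"

primrec fv_pctx :: "pctx \<Rightarrow> nat set" where
  "fv_pctx (PlainC E) = fv_ectx E"
| "fv_pctx (NamC k E) = fv_ectx E"

primrec cv_val :: "val \<Rightarrow> nat set" and cv_trm :: "trm \<Rightarrow> nat set" and cv_prog :: "prog \<Rightarrow> nat set" where
  "cv_val (Var n) = {}"
| "cv_val (Lam t) = cv_trm t"
| "cv_val Callcc = {}"
| "cv_trm (Val v) = cv_val v"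
| "cv_trm (App t s) = cv_trm t \<union> cv_trm s"
| "cv_trm (Abort p) = cv_prog p"
| "cv_prog (Trm t) = cv_trm t"
| "cv_prog (Nam k t) = insert k (cv_trm t)"


subsection \<open>Renaming\<close>

definition up_ren :: "(nat \<Rightarrow> nat) \<Rightarrow> nat \<Rightarrow> nat" where
  "up_ren \<rho> = case_nat 0 (\<lambda>n. Suc (\<rho> n))"

primrec ren_val :: "(nat \<Rightarrow> nat) \<Rightarrow> val \<Rightarrow> val"
  and ren_trm :: "(nat \<Rightarrow> nat) \<Rightarrow> trm \<Rightarrow> trm"
  and ren_prog :: "(nat \<Rightarrow> nat) \<Rightarrow> prog \<Rightarrow> prog" where
  "ren_val \<rho> (Var n) = Var (\<rho> n)"
| "ren_val \<rho> (Lam t) = Lam (ren_trm (up_ren \<rho>) t)"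
| "ren_val \<rho> Callcc = Callcc"
| "ren_trm \<rho> (Val v) = Val (ren_val \<rho> v)"
| "ren_trm \<rho> (App t s) = App (ren_trm \<rho> t) (ren_trm \<rho> s)"
| "ren_trm \<rho> (Abort p) = Abort (ren_prog \<rho> p)"
| "ren_prog \<rho> (Trm t) = Trm (ren_trm \<rho> t)"
| "ren_prog \<rho> (Nam k t) = Nam k (ren_trm \<rho> t)"

primrec ren_ectx :: "(nat \<Rightarrow> nat) \<Rightarrow> ectx \<Rightarrow> ectx" where
  "ren_ectx \<rho> Hole = Hole"
| "ren_ectx \<rho> (ArgC v E) = ArgC (ren_val \<rho> v) (ren_ectx \<rho> E)"
| "ren_ectx \<rho> (FunC E t) = FunC (ren_ectx \<rho> E) (ren_trm \<rho> t)"

primrec ren_pctx :: "(nat \<Rightarrow> nat) \<Rightarrow> pctx \<Rightarrow> pctx" where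
  "ren_pctx \<rho> (PlainC E) = PlainC (ren_ectx \<rho> E)"
| "ren_pctx \<rho> (NamC k E) = NamC k (ren_ectx \<rho> E)"


subsection \<open>Substitution of values for variables\<close>

definition up_sub :: "(nat \<Rightarrow> val) \<Rightarrow> nat \<Rightarrow> val" where
  "up_sub \<sigma> = case_nat (Var 0) (\<lambda>n. ren_val Suc (\<sigma> n))"

primrec sub_val :: "(nat \<Rightarrow> val) \<Rightarrow> val \<Rightarrow> val"
  and sub_trm :: "(nat \<Rightarrow> val) \<Rightarrow> trm \<Rightarrow> trm"
  and sub_prog :: "(nat \<Rightarrow> val) \<Rightarrow> prog \<Rightarrow> prog" where
  "sub_val \<sigma> (Var n) = \<sigma> n"
| "sub_val \<sigma> (Lam t) = Lam (sub_trm (up_sub \<sigma>) t)"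
| "sub_val \<sigma> Callcc = Callcc"
| "sub_trm \<sigma> (Val v) = Val (sub_val \<sigma> v)"
| "sub_trm \<sigma> (App t s) = App (sub_trm \<sigma> t) (sub_trm \<sigma> s)"
| "sub_trm \<sigma> (Abort p) = Abort (sub_prog \<sigma> p)"
| "sub_prog \<sigma> (Trm t) = Trm (sub_trm \<sigma> t)"
| "sub_prog \<sigma> (Nam k t) = Nam k (sub_trm \<sigma> t)"

text \<open>\<open>substv_trm x v t\<close> is \<open>t{v/x}\<close> and \<open>substv_prog x v p\<close> is \<open>p{v/x}\<close>, for a free variable \<open>x\<close>.\<close>

definition substv_trm :: "nat \<Rightarrow> val \<Rightarrow> trm \<Rightarrow> trm" where
  "substv_trm x v t = sub_trm (Var(x := v)) t"

definition substv_prog :: "nat \<Rightarrow> val \<Rightarrow> prog \<Rightarrow> prog" where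
  "substv_prog x v p = sub_prog (Var(x := v)) p"

text \<open>\<open>inst t v\<close> replaces the outermost bound variable of the body \<open>t\<close> of an abstraction \<open>Lam t\<close>.\<close>

definition inst :: "trm \<Rightarrow> val \<Rightarrow> trm" where
  "inst t v = sub_trm (case_nat v Var) t"

text \<open>\<open>lambda x t\<close> is the named abstraction \<open>\<lambda>x. t\<close>, binding the free variable \<open>x\<close> of \<open>t\<close>.\<close>

definition bind_var :: "nat \<Rightarrow> nat \<Rightarrow> nat" where
  "bind_var x n = (if n = x then 0 else Suc n)"

definition lambda :: "nat \<Rightarrow> trm \<Rightarrow> val" where
  "lambda x t = Lam (ren_trm (bind_var x) t)"


subsection \<open>Substitution of contexts for context variables\<close>

text \<open>\<open>substc_prog k F p\<close> is \<open>p{F/k}\<close>; it is capture-avoiding because \<open>F\<close> is shifted under binders.\<close>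

primrec substc_val :: "nat \<Rightarrow> pctx \<Rightarrow> val \<Rightarrow> val"
  and substc_trm :: "nat \<Rightarrow> pctx \<Rightarrow> trm \<Rightarrow> trm"
  and substc_prog :: "nat \<Rightarrow> pctx \<Rightarrow> prog \<Rightarrow> prog" where
  "substc_val k F (Var n) = Var n"
| "substc_val k F (Lam t) = Lam (substc_trm k (ren_pctx Suc F) t)"
| "substc_val k F Callcc = Callcc"
| "substc_trm k F (Val v) = Val (substc_val k F v)"
| "substc_trm k F (App t s) = App (substc_trm k F t) (substc_trm k F s)"
| "substc_trm k F (Abort p) = Abort (substc_prog k F p)"
| "substc_prog k F (Trm t) = Trm (substc_trm k F t)"
| "substc_prog k F (Nam k' t) =
     (if k' = k then plug F (substc_trm k F t) else Nam k' (substc_trm k F t))"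


subsection \<open>Reduction\<close>

text \<open>
  In \<open>step_callcc\<close>, the value \<open>Lam (Abort (plug (ren_pctx Suc F) (Val (Var 0))))\<close> is
  \<open>\<lambda>y. \<A> F[y]\<close> with \<open>y\<close> not free in \<open>F\<close>; see \<open>lambda_callcc\<close> below for the named form, and
  \<open>inst_lambda\<close> for the named form of the contractum in \<open>step_beta\<close>.
\<close>

inductive step :: "prog \<Rightarrow> prog \<Rightarrow> bool" (infix "\<longmapsto>" 50) where
  step_beta: "plug F (App (Val (Lam t)) (Val v)) \<longmapsto> plug F (inst t v)"
| step_callcc: "plug F (App (Val Callcc) (Val v)) \<longmapsto>
    plug F (App (Val v) (Val (Lam (Abort (plug (ren_pctx Suc F) (Val (Var 0)))))))"
| step_abort: "plug F (Abort p) \<longmapsto> p"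

abbreviation steps :: "prog \<Rightarrow> prog \<Rightarrow> bool" (infix "\<longmapsto>*" 50) where
  "p \<longmapsto>* q \<equiv> step\<^sup>*\<^sup>* p q"

definition evaluates :: "prog \<Rightarrow> prog \<Rightarrow> bool" (infix "\<Down>" 50) where
  "p \<Down> q \<longleftrightarrow> p \<longmapsto>* q \<and> (\<nexists>q'. q \<longmapsto> q')"


subsection \<open>Relations\<close>

type_synonym prel = "(prog \<times> prog) set"

text \<open>
  ``For fresh \<open>k\<close>'' and ``for fresh \<open>x\<close>'' mean \<^emph>\<open>for some\<close> fresh name.  For a relation that is not
  closed under renaming this differs from \<^emph>\<open>for all\<close> fresh names; with the latter, the
  functions defined from these extensions would not be continuous.
\<close>

definition trm_rel :: "prel \<Rightarrow> (trm \<times> trm) set" where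
  "trm_rel R = {(t, s). \<exists>k. k \<notin> cv_trm t \<union> cv_trm s \<and> (Nam k t, Nam k s) \<in> R}"

definition val_rel :: "prel \<Rightarrow> (val \<times> val) set" where
  "val_rel R = {(v, w). \<exists>x. x \<notin> fv_val v \<union> fv_val w \<and>
     (App (Val v) (Val (Var x)), App (Val w) (Val (Var x))) \<in> trm_rel R}"

definition ctx_rel :: "prel \<Rightarrow> (pctx \<times> pctx) set" where
  "ctx_rel R = {(F, F'). \<exists>x. x \<notin> fv_pctx F \<union> fv_pctx F' \<and>
     (plug F (Val (Var x)), plug F' (Val (Var x))) \<in> R}"

definition open_rel :: "prel \<Rightarrow> prel" where
  "open_rel R = {(plug F (App (Val (Var x)) (Val v)), plug F' (App (Val (Var x)) (Val w)))
     | F F' x v w. (F, F') \<in> ctx_rel R \<and> (v, w) \<in> val_rel R}"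


subsection \<open>Diacritical progress\<close>

definition simulates :: "prel \<Rightarrow> prel \<Rightarrow> prel \<Rightarrow> bool" where
  "simulates R S T \<longleftrightarrow> (\<forall>p q. (p, q) \<in> R \<longrightarrow>
     (\<forall>p'. p \<longmapsto> p' \<longrightarrow> (\<exists>q'. q \<longmapsto>* q' \<and> (p', q') \<in> T)) \<and>
     (\<forall>v. p = Trm (Val v) \<longrightarrow> (\<exists>w. q \<Down> Trm (Val w))) \<and>
     (\<forall>F x v. p = plug F (App (Val (Var x)) (Val v)) \<longrightarrow>
        (\<exists>F' w. q \<Down> plug F' (App (Val (Var x)) (Val w)) \<and>
           (plug F (App (Val (Var x)) (Val v)), plug F' (App (Val (Var x)) (Val w))) \<in> open_rel T)) \<and>
     (\<forall>k v. p = Nam k (Val v) \<longrightarrow> (\<exists>w. q \<Down> Nam k (Val w) \<and> (v, w) \<in> val_rel S)))"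

text \<open>
  The symmetric conditions are the same clauses for the converse relations; all the extensions
  above commute with converse.
\<close>

definition progress :: "prel \<Rightarrow> prel \<Rightarrow> prel \<Rightarrow> bool" where
  "progress R S T \<longleftrightarrow> R \<subseteq> S \<and> S \<subseteq> T \<and> simulates R S T \<and> simulates (R\<inverse>) (S\<inverse>) (T\<inverse>)"


subsection \<open>Functions on relations and diacritical compatibility\<close>

text \<open>
  Union of functions is the pointwise supremum of the function lattice: \<open>sup f g\<close> is
  \<open>\<lambda>R. f R \<union> g R\<close>, and \<open>Sup G\<close> is the function with which a set \<open>G\<close> of functions is identified.
\<close>

definition hat :: "(prel \<Rightarrow> prel) \<Rightarrow> prel \<Rightarrow> prel" where
  "hat f = sup f id"

definition omega :: "(prel \<Rightarrow> prel) \<Rightarrow> prel \<Rightarrow> prel" where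
  "omega f = (SUP n. f ^^ n)"

definition rel_continuous :: "(prel \<Rightarrow> prel) \<Rightarrow> bool" where
  "rel_continuous f \<longleftrightarrow> (\<forall>R. f R \<subseteq> \<Union> {f S | S. S \<subseteq> R \<and> finite S})"

definition evolves :: "(prel \<Rightarrow> prel) \<Rightarrow> (prel \<Rightarrow> prel) \<Rightarrow> (prel \<Rightarrow> prel) \<Rightarrow> bool" where
  "evolves f g h \<longleftrightarrow> (\<forall>R T. progress R R T \<longrightarrow> progress (f R) (g R) (h T))"

definition strongly_evolves :: "(prel \<Rightarrow> prel) \<Rightarrow> (prel \<Rightarrow> prel) \<Rightarrow> (prel \<Rightarrow> prel) \<Rightarrow> bool" where
  "strongly_evolves f g h \<longleftrightarrow> (\<forall>R S T. progress R S T \<longrightarrow> progress (f R) (g S) (h T))"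

definition strong_subset :: "(prel \<Rightarrow> prel) set \<Rightarrow> (prel \<Rightarrow> prel) set \<Rightarrow> bool" where
  "strong_subset \<F> \<S> \<longleftrightarrow> \<S> \<subseteq> \<F> \<and>
     (\<forall>f\<in>\<S>. strongly_evolves f (omega (hat (Sup \<S>))) (omega (hat (Sup \<F>)))) \<and>
     (\<forall>f\<in>\<F>. evolves f (omega (hat (Sup \<S>)) \<circ> hat (Sup \<F>) \<circ> omega (hat (Sup \<S>)))
                     (omega (hat (Sup \<F>))))"

definition diacritically_compatible :: "(prel \<Rightarrow> prel) set \<Rightarrow> bool" where
  "diacritically_compatible \<F> \<longleftrightarrow> (\<forall>f\<in>\<F>. rel_continuous f) \<and> (\<exists>\<S>. strong_subset \<F> \<S>)"

definition strong :: "(prel \<Rightarrow> prel) set \<Rightarrow> (prel \<Rightarrow> prel) set" where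
  "strong \<F> = \<Union> {\<S>. strong_subset \<F> \<S>}"


subsection \<open>Up-to techniques\<close>

definition ut_refl :: "prel \<Rightarrow> prel" where
  "ut_refl R = {(p, p) | p. True}"

definition ut_result :: "prel \<Rightarrow> prel" where
  "ut_result R = {(Trm (Val v), Trm (Val w)) | v w. True}"

definition ut_abort :: "prel \<Rightarrow> prel" where
  "ut_abort R = {(Nam k (Abort p), Nam k (Abort q)) | k p q. (p, q) \<in> R}"

definition ut_lam :: "prel \<Rightarrow> prel" where
  "ut_lam R = {(Nam k (Val (lambda x t)), Nam k (Val (lambda x s))) | k x t s. (t, s) \<in> trm_rel R}"

definition ut_substv :: "prel \<Rightarrow> prel" where
  "ut_substv R = {(substv_prog x v p, substv_prog x w q)
     | x v w p q. (p, q) \<in> R \<and> (v, w) \<in> val_rel R}"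

definition ut_substc :: "prel \<Rightarrow> prel" where
  "ut_substc R = {(substc_prog k F p, substc_prog k F' q)
     | k F F' p q. (p, q) \<in> R \<and> (F, F') \<in> ctx_rel R}"

definition ut_red :: "prel \<Rightarrow> prel" where
  "ut_red R = {(p, q). \<exists>p' q'. p \<longmapsto>* p' \<and> q \<longmapsto>* q' \<and> (p', q') \<in> R}"


subsection \<open>The de Bruijn operations in named form\<close>

lemma up_ren_comp: "up_ren \<rho> (up_ren \<rho>' n) = up_ren (\<lambda>n. \<rho> (\<rho>' n)) n"
  by (cases n) (auto simp: up_ren_def)

lemma ren_ren:
  "ren_val \<rho> (ren_val \<rho>' v) = ren_val (\<lambda>n. \<rho> (\<rho>' n)) v"
  "ren_trm \<rho> (ren_trm \<rho>' t) = ren_trm (\<lambda>n. \<rho> (\<rho>' n)) t"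
  "ren_prog \<rho> (ren_prog \<rho>' p) = ren_prog (\<lambda>n. \<rho> (\<rho>' n)) p"
  by (induction v and t and p arbitrary: \<rho> \<rho>' and \<rho> \<rho>' and \<rho> \<rho>') (auto simp: up_ren_comp)

lemma up_sub_up_ren: "up_sub \<sigma> (up_ren \<rho> n) = up_sub (\<lambda>n. \<sigma> (\<rho> n)) n"
  by (cases n) (auto simp: up_ren_def up_sub_def)

lemma sub_ren:
  "sub_val \<sigma> (ren_val \<rho> v) = sub_val (\<lambda>n. \<sigma> (\<rho> n)) v"
  "sub_trm \<sigma> (ren_trm \<rho> t) = sub_trm (\<lambda>n. \<sigma> (\<rho> n)) t"
  "sub_prog \<sigma> (ren_prog \<rho> p) = sub_prog (\<lambda>n. \<sigma> (\<rho> n)) p"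
  by (induction v and t and p arbitrary: \<sigma> \<rho> and \<sigma> \<rho> and \<sigma> \<rho>) (auto simp: up_sub_up_ren)

lemma up_sub_Var: "up_sub (\<lambda>n. Var (\<rho> n)) = (\<lambda>n. Var (up_ren \<rho> n))"
  by (rule ext) (auto simp: up_ren_def up_sub_def split: nat.split)

lemma sub_Var:
  "sub_val (\<lambda>n. Var (\<rho> n)) v = ren_val \<rho> v"
  "sub_trm (\<lambda>n. Var (\<rho> n)) t = ren_trm \<rho> t"
  "sub_prog (\<lambda>n. Var (\<rho> n)) p = ren_prog \<rho> p"
  by (induction v and t and p arbitrary: \<rho> and \<rho> and \<rho>) (auto simp: up_sub_Var)

lemma ren_cong:
  "(\<And>n. n \<in> fv_val v \<Longrightarrow> \<rho> n = \<rho>' n) \<Longrightarrow> ren_val \<rho> v = ren_val \<rho>' v"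
  "(\<And>n. n \<in> fv_trm t \<Longrightarrow> \<rho> n = \<rho>' n) \<Longrightarrow> ren_trm \<rho> t = ren_trm \<rho>' t"
  "(\<And>n. n \<in> fv_prog p \<Longrightarrow> \<rho> n = \<rho>' n) \<Longrightarrow> ren_prog \<rho> p = ren_prog \<rho>' p"
proof (induction v and t and p arbitrary: \<rho> \<rho>' and \<rho> \<rho>' and \<rho> \<rho>')
  case (Lam t)
  have "ren_trm (up_ren \<rho>) t = ren_trm (up_ren \<rho>') t"
    by (rule Lam.IH) (use Lam.prems in \<open>auto simp: up_ren_def split: nat.split\<close>)
  then show ?case by simp
next
  case (Val v)
  have "ren_val \<rho> v = ren_val \<rho>' v" by (rule Val.IH) (simp add: Val.prems)
  then show ?case by simp
next
  case (App t s)
  have "ren_trm \<rho> t = ren_trm \<rho>' t" by (rule App.IH(1)) (simp add: App.prems)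
  moreover have "ren_trm \<rho> s = ren_trm \<rho>' s" by (rule App.IH(2)) (simp add: App.prems)
  ultimately show ?case by simp
next
  case (Abort p)
  have "ren_prog \<rho> p = ren_prog \<rho>' p" by (rule Abort.IH) (simp add: Abort.prems)
  then show ?case by simp
next
  case (Trm t)
  have "ren_trm \<rho> t = ren_trm \<rho>' t" by (rule Trm.IH) (simp add: Trm.prems)
  then show ?case by simp
next
  case (Nam k t)
  have "ren_trm \<rho> t = ren_trm \<rho>' t" by (rule Nam.IH) (simp add: Nam.prems)
  then show ?case by simp
qed simp_all

lemma ren_ectx_cong: "(\<And>n. n \<in> fv_ectx E \<Longrightarrow> \<rho> n = \<rho>' n) \<Longrightarrow> ren_ectx \<rho> E = ren_ectx \<rho>' E"
  by (induction E) (auto intro: ren_cong)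

lemma ren_pctx_cong: "(\<And>n. n \<in> fv_pctx F \<Longrightarrow> \<rho> n = \<rho>' n) \<Longrightarrow> ren_pctx \<rho> F = ren_pctx \<rho>' F"
  by (cases F) (auto intro: ren_ectx_cong)

lemma ren_plug: "ren_prog \<rho> (plug F t) = plug (ren_pctx \<rho> F) (ren_trm \<rho> t)"
proof -
  have "ren_trm \<rho> (eplug E t) = eplug (ren_ectx \<rho> E) (ren_trm \<rho> t)" for E
    by (induction E) auto
  then show ?thesis by (cases F) auto
qed

lemma lambda_alpha:
  assumes "y \<notin> fv_trm t"
  shows "lambda y (substv_trm x (Var y) t) = lambda x t"
proof -
  have "Var(x := Var y) = (\<lambda>n. Var (if n = x then y else n))" by auto
  then have "substv_trm x (Var y) t = ren_trm (\<lambda>n. if n = x then y else n) t"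
    unfolding substv_trm_def by (simp only: sub_Var)
  then show ?thesis
    using assms by (auto simp: lambda_def ren_ren bind_var_def intro!: ren_cong)
qed

lemma inst_lambda: "lambda x t = Lam b \<Longrightarrow> inst b v = substv_trm x v t"
proof -
  assume "lambda x t = Lam b"
  then have b: "b = ren_trm (bind_var x) t" by (simp add: lambda_def)
  have "(\<lambda>n. case_nat v Var (bind_var x n)) = Var(x := v)" by (auto simp: bind_var_def)
  then show ?thesis by (simp add: b inst_def substv_trm_def sub_ren)
qed

lemma lambda_callcc:
  assumes "y \<notin> fv_pctx F"
  shows "Lam (Abort (plug (ren_pctx Suc F) (Val (Var 0)))) = lambda y (Abort (plug F (Val (Var y))))"
proof -
  have "ren_pctx (bind_var y) F = ren_pctx Suc F"
    by (rule ren_pctx_cong) (use assms in \<open>auto simp: bind_var_def\<close>)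
  then show ?thesis by (simp add: lambda_def ren_plug bind_var_def)
qed

lemma substc_lambda:
  assumes "x \<notin> fv_pctx F"
  shows "substc_val k F (lambda x t) = lambda x (substc_trm k F t)"
proof -
  have gen:
    "ren_val \<rho> (substc_val k F v) = substc_val k (ren_pctx \<rho> F) (ren_val \<rho> v)"
    "ren_trm \<rho> (substc_trm k F t) = substc_trm k (ren_pctx \<rho> F) (ren_trm \<rho> t)"
    "ren_prog \<rho> (substc_prog k F p) = substc_prog k (ren_pctx \<rho> F) (ren_prog \<rho> p)"
    for \<rho> v t p F
  proof (induction v and t and p arbitrary: \<rho> F and \<rho> F and \<rho> F)
    case (Lam t)
    have "ren_ectx (up_ren \<rho>) (ren_ectx Suc E) = ren_ectx Suc (ren_ectx \<rho> E)" for E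
      by (induction E) (auto simp: ren_ren up_ren_def)
    then have "ren_pctx (up_ren \<rho>) (ren_pctx Suc F) = ren_pctx Suc (ren_pctx \<rho> F)"
      by (cases F) auto
    then show ?case by (simp add: Lam.IH)
  qed (auto simp: ren_plug)
  have "ren_pctx (bind_var x) F = ren_pctx Suc F"
    by (rule ren_pctx_cong) (use assms in \<open>auto simp: bind_var_def\<close>)
  then show ?thesis by (simp add: lambda_def gen)
qed

end

theory Submission
  imports Defs
begin

text \<open>
  A relation closed under \<open>ut_refl\<close> and \<open>ut_substv\<close> is insensitive to the choice of the fresh names in
  the value and context extensions.  Substitutions commute with reduction, so after substituting
  related values or contexts in a related pair the only new behaviour appears at a stuck term
  \<open>F[x r]\<close> with \<open>x\<close> replaced by \<open>v\<close>, or at a named value \<open>k r\<close> with \<open>k\<close> replaced by a context.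
  The former is simulated by playing the bisimulation game on \<open>k' (v z)\<close> for fresh \<open>k'\<close> and \<open>z\<close>, and then
  substituting \<open>F\<close> for \<open>k'\<close> and \<open>r\<close> for \<open>z\<close>; this step is active, so \<open>ut_substc\<close> may be used.
  The latter plays the game on \<open>F[x]\<close>, but needs the values \<open>r\<close> themselves to progress, which is
  why \<open>ut_substc\<close> does not evolve strongly.
\<close>

section \<open>Substitution calculus\<close>

lemma finite_fv [simp]: "finite (fv_val v)" "finite (fv_trm t)" "finite (fv_prog p)"
proof (induction v and t and p)
  case (Lam t)
  have "{n. Suc n \<in> fv_trm t} = Suc -` fv_trm t" by auto
  with Lam show ?case by (simp add: finite_vimageI)
qed simp_all

lemma finite_cv [simp]: "finite (cv_val v)" "finite (cv_trm t)" "finite (cv_prog p)"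
  by (induction v and t and p) simp_all

lemma finite_fv_ectx [simp]: "finite (fv_ectx E)"
  by (induction E) simp_all

lemma finite_fv_pctx [simp]: "finite (fv_pctx F)"
  by (cases F) simp_all

lemma ex_fresh: "finite A \<Longrightarrow> \<exists>x::nat. x \<notin> A"
  by (rule ex_new_if_finite) simp_all

lemma cv_ren [simp]:
  "cv_val (ren_val \<rho> v) = cv_val v"
  "cv_trm (ren_trm \<rho> t) = cv_trm t"
  "cv_prog (ren_prog \<rho> p) = cv_prog p"
  by (induction v and t and p arbitrary: \<rho> and \<rho> and \<rho>) auto

lemma fv_ren:
  "fv_val (ren_val \<rho> v) = \<rho> ` fv_val v"
  "fv_trm (ren_trm \<rho> t) = \<rho> ` fv_trm t"
  "fv_prog (ren_prog \<rho> p) = \<rho> ` fv_prog p"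
proof (induction v and t and p arbitrary: \<rho> and \<rho> and \<rho>)
  case (Lam t)
  have "Suc n \<in> up_ren \<rho> ` A \<longleftrightarrow> n \<in> \<rho> ` {n. Suc n \<in> A}" for n A
  proof
    assume "Suc n \<in> up_ren \<rho> ` A"
    then obtain m where "m \<in> A" "Suc n = up_ren \<rho> m" by blast
    then show "n \<in> \<rho> ` {n. Suc n \<in> A}" by (cases m) (auto simp: up_ren_def)
  next
    assume "n \<in> \<rho> ` {n. Suc n \<in> A}"
    then obtain m where "Suc m \<in> A" "n = \<rho> m" by blast
    then show "Suc n \<in> up_ren \<rho> ` A"
      by (intro image_eqI[of _ _ "Suc m"]) (auto simp: up_ren_def)
  qed
  with Lam show ?case by auto
qed auto

lemma lambda_fresh: "x \<notin> fv_val (lambda x t)"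
  by (auto simp: lambda_def fv_ren bind_var_def split: if_splits)

lemma cv_lambda [simp]: "cv_val (lambda x t) = cv_trm t"
  by (simp add: lambda_def)

section \<open>Simultaneous substitution of values\<close>

lemma up_sub_Var_id [simp]: "up_sub Var = Var"
  by (auto simp: up_sub_def split: nat.split)

lemma sub_id [simp]: "sub_val Var v = v" "sub_trm Var t = t" "sub_prog Var p = p"
  by (induction v and t and p) simp_all

lemma ren_up_sub: "ren_val (up_ren \<rho>) (up_sub \<sigma> n) = up_sub (\<lambda>n. ren_val \<rho> (\<sigma> n)) n"
  by (auto simp: up_sub_def up_ren_def ren_ren split: nat.split)

lemma ren_sub:
  "ren_val \<rho> (sub_val \<sigma> v) = sub_val (\<lambda>n. ren_val \<rho> (\<sigma> n)) v"
  "ren_trm \<rho> (sub_trm \<sigma> t) = sub_trm (\<lambda>n. ren_val \<rho> (\<sigma> n)) t"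
  "ren_prog \<rho> (sub_prog \<sigma> p) = sub_prog (\<lambda>n. ren_val \<rho> (\<sigma> n)) p"
  by (induction v and t and p arbitrary: \<rho> \<sigma> and \<rho> \<sigma> and \<rho> \<sigma>) (simp_all add: ren_up_sub)

lemma sub_up_sub: "sub_val (up_sub \<sigma>) (up_sub \<tau> n) = up_sub (\<lambda>n. sub_val \<sigma> (\<tau> n)) n"
  by (auto simp: up_sub_def sub_ren ren_sub split: nat.split)

lemma sub_sub:
  "sub_val \<sigma> (sub_val \<tau> v) = sub_val (\<lambda>n. sub_val \<sigma> (\<tau> n)) v"
  "sub_trm \<sigma> (sub_trm \<tau> t) = sub_trm (\<lambda>n. sub_val \<sigma> (\<tau> n)) t"
  "sub_prog \<sigma> (sub_prog \<tau> p) = sub_prog (\<lambda>n. sub_val \<sigma> (\<tau> n)) p"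
  by (induction v and t and p arbitrary: \<sigma> \<tau> and \<sigma> \<tau> and \<sigma> \<tau>) (simp_all add: sub_up_sub)

lemma sub_cong:
  "(\<And>n. n \<in> fv_val v \<Longrightarrow> \<sigma> n = \<tau> n) \<Longrightarrow> sub_val \<sigma> v = sub_val \<tau> v"
  "(\<And>n. n \<in> fv_trm t \<Longrightarrow> \<sigma> n = \<tau> n) \<Longrightarrow> sub_trm \<sigma> t = sub_trm \<tau> t"
  "(\<And>n. n \<in> fv_prog p \<Longrightarrow> \<sigma> n = \<tau> n) \<Longrightarrow> sub_prog \<sigma> p = sub_prog \<tau> p"
proof (induction v and t and p arbitrary: \<sigma> \<tau> and \<sigma> \<tau> and \<sigma> \<tau>)
  case (Lam t)
  have "sub_trm (up_sub \<sigma>) t = sub_trm (up_sub \<tau>) t"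
    by (rule Lam.IH) (use Lam.prems in \<open>auto simp: up_sub_def split: nat.split\<close>)
  then show ?case by simp
next
  case (App t s)
  have "sub_trm \<sigma> t = sub_trm \<tau> t" by (rule App.IH(1)) (simp add: App.prems)
  moreover have "sub_trm \<sigma> s = sub_trm \<tau> s" by (rule App.IH(2)) (simp add: App.prems)
  ultimately show ?case by simp
next
  case (Val v)
  then show ?case by (metis fv_trm.simps(1) sub_trm.simps(1))
next
  case (Abort p)
  then show ?case by (metis fv_trm.simps(3) sub_trm.simps(3))
next
  case (Trm t)
  then show ?case by (metis fv_prog.simps(1) sub_prog.simps(1))
next
  case (Nam k t)
  then show ?case by (metis fv_prog.simps(2) sub_prog.simps(2))
qed simp_all

lemma sub_fresh [simp]:
  "x \<notin> fv_val v \<Longrightarrow> sub_val (Var(x := w)) v = v"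
  "x \<notin> fv_trm t \<Longrightarrow> sub_trm (Var(x := w)) t = t"
proof -
  show "sub_val (Var(x := w)) v = v" if "x \<notin> fv_val v"
    using that sub_cong(1)[of v "Var(x := w)" Var] by (metis fun_upd_other sub_id(1))
  show "sub_trm (Var(x := w)) t = t" if "x \<notin> fv_trm t"
    using that sub_cong(2)[of t "Var(x := w)" Var] by (metis fun_upd_other sub_id(2))
qed

primrec sub_ectx :: "(nat \<Rightarrow> val) \<Rightarrow> ectx \<Rightarrow> ectx" where
  "sub_ectx \<sigma> Hole = Hole"
| "sub_ectx \<sigma> (ArgC v E) = ArgC (sub_val \<sigma> v) (sub_ectx \<sigma> E)"
| "sub_ectx \<sigma> (FunC E t) = FunC (sub_ectx \<sigma> E) (sub_trm \<sigma> t)"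

primrec sub_pctx :: "(nat \<Rightarrow> val) \<Rightarrow> pctx \<Rightarrow> pctx" where
  "sub_pctx \<sigma> (PlainC E) = PlainC (sub_ectx \<sigma> E)"
| "sub_pctx \<sigma> (NamC k E) = NamC k (sub_ectx \<sigma> E)"

lemma sub_eplug: "sub_trm \<sigma> (eplug E t) = eplug (sub_ectx \<sigma> E) (sub_trm \<sigma> t)"
  by (induction E) simp_all

lemma sub_plug: "sub_prog \<sigma> (plug F t) = plug (sub_pctx \<sigma> F) (sub_trm \<sigma> t)"
  by (cases F) (simp_all add: sub_eplug)

lemma sub_ectx_id [simp]: "sub_ectx Var E = E"
  by (induction E) simp_all

lemma sub_pctx_id [simp]: "sub_pctx Var F = F"
  by (cases F) simp_all

lemma sub_ectx_fresh: "x \<notin> fv_ectx E \<Longrightarrow> sub_ectx (Var(x := w)) E = E"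
  by (induction E) simp_all

lemma sub_pctx_fresh [simp]: "x \<notin> fv_pctx F \<Longrightarrow> sub_pctx (Var(x := w)) F = F"
  by (cases F) (simp_all add: sub_ectx_fresh)

lemma sub_ren_ectx: "sub_ectx \<sigma> (ren_ectx \<rho> E) = sub_ectx (\<lambda>n. \<sigma> (\<rho> n)) E"
  by (induction E) (simp_all add: sub_ren)

lemma sub_ren_pctx: "sub_pctx \<sigma> (ren_pctx \<rho> F) = sub_pctx (\<lambda>n. \<sigma> (\<rho> n)) F"
  by (cases F) (simp_all add: sub_ren_ectx)

lemma ren_sub_ectx: "ren_ectx \<rho> (sub_ectx \<sigma> E) = sub_ectx (\<lambda>n. ren_val \<rho> (\<sigma> n)) E"
  by (induction E) (simp_all add: ren_sub)

lemma ren_sub_pctx: "ren_pctx \<rho> (sub_pctx \<sigma> F) = sub_pctx (\<lambda>n. ren_val \<rho> (\<sigma> n)) F"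
  by (cases F) (simp_all add: ren_sub_ectx)

lemma sub_up_ren_pctx: "sub_pctx (up_sub \<sigma>) (ren_pctx Suc F) = ren_pctx Suc (sub_pctx \<sigma> F)"
  by (simp add: sub_ren_pctx ren_sub_pctx up_sub_def)

text \<open>By \<open>sub_sub\<close>, both sides collapse to one simultaneous substitution; these
  agree at index 0 and, after cancelling the shift, at every successor.\<close>

lemma sub_inst: "sub_trm \<sigma> (inst t v) = inst (sub_trm (up_sub \<sigma>) t) (sub_val \<sigma> v)"
proof -
  have "(\<lambda>n. sub_val \<sigma> (case_nat v Var n))
      = (\<lambda>n. sub_val (case_nat (sub_val \<sigma> v) Var) (up_sub \<sigma> n))"
    by (auto simp: up_sub_def sub_ren split: nat.split)
  then show ?thesis by (simp add: inst_def sub_sub)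
qed

text \<open>Composition is what substituting \<open>G\<close> for \<open>k\<close> does to a context
  \<open>k E\<close>: the evaluation context ends up below \<open>G\<close>. Only the outer context
  can therefore carry a name.\<close>

primrec ecomp :: "ectx \<Rightarrow> ectx \<Rightarrow> ectx" where
  "ecomp Hole E' = E'"
| "ecomp (ArgC v E) E' = ArgC v (ecomp E E')"
| "ecomp (FunC E t) E' = FunC (ecomp E E') t"

primrec pcomp :: "pctx \<Rightarrow> ectx \<Rightarrow> pctx" where
  "pcomp (PlainC E) E' = PlainC (ecomp E E')"
| "pcomp (NamC k E) E' = NamC k (ecomp E E')"

lemma plug_pcomp: "plug (pcomp F E) t = plug F (eplug E t)"
proof -
  have "eplug (ecomp E1 E) t = eplug E1 (eplug E t)" for E1
    by (induction E1) simp_all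
  then show ?thesis by (cases F) simp_all
qed

lemma ren_pcomp: "ren_pctx \<rho> (pcomp F E) = pcomp (ren_pctx \<rho> F) (ren_ectx \<rho> E)"
proof -
  have "ren_ectx \<rho> (ecomp E1 E) = ecomp (ren_ectx \<rho> E1) (ren_ectx \<rho> E)" for E1
    by (induction E1) simp_all
  then show ?thesis by (cases F) simp_all
qed

section \<open>Substitution of contexts for context variables\<close>

primrec substc_ectx :: "nat \<Rightarrow> pctx \<Rightarrow> ectx \<Rightarrow> ectx" where
  "substc_ectx k G Hole = Hole"
| "substc_ectx k G (ArgC v E) = ArgC (substc_val k G v) (substc_ectx k G E)"
| "substc_ectx k G (FunC E t) = FunC (substc_ectx k G E) (substc_trm k G t)"

primrec substc_pctx :: "nat \<Rightarrow> pctx \<Rightarrow> pctx \<Rightarrow> pctx" where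
  "substc_pctx k G (PlainC E) = PlainC (substc_ectx k G E)"
| "substc_pctx k G (NamC j E) =
     (if j = k then pcomp G (substc_ectx k G E) else NamC j (substc_ectx k G E))"

lemma substc_eplug: "substc_trm k G (eplug E t) = eplug (substc_ectx k G E) (substc_trm k G t)"
  by (induction E) simp_all

lemma substc_plug: "substc_prog k G (plug F t) = plug (substc_pctx k G F) (substc_trm k G t)"
  by (cases F) (simp_all add: substc_eplug plug_pcomp)

lemma substc_fresh [simp]:
  "k \<notin> cv_val v \<Longrightarrow> substc_val k F v = v"
  "k \<notin> cv_trm t \<Longrightarrow> substc_trm k F t = t"
  "k \<notin> cv_prog p \<Longrightarrow> substc_prog k F p = p"
  by (induction v and t and p arbitrary: F and F and F) auto

lemma ren_up_ren_ectx: "ren_ectx (up_ren \<rho>) (ren_ectx Suc E) = ren_ectx Suc (ren_ectx \<rho> E)"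
  by (induction E) (simp_all add: ren_ren up_ren_def)

lemma ren_up_ren_pctx: "ren_pctx (up_ren \<rho>) (ren_pctx Suc F) = ren_pctx Suc (ren_pctx \<rho> F)"
  by (cases F) (simp_all add: ren_up_ren_ectx)

lemma ren_substc:
  "ren_val \<rho> (substc_val k F v) = substc_val k (ren_pctx \<rho> F) (ren_val \<rho> v)"
  "ren_trm \<rho> (substc_trm k F t) = substc_trm k (ren_pctx \<rho> F) (ren_trm \<rho> t)"
  "ren_prog \<rho> (substc_prog k F p) = substc_prog k (ren_pctx \<rho> F) (ren_prog \<rho> p)"
  by (induction v and t and p arbitrary: \<rho> F and \<rho> F and \<rho> F)
    (simp_all add: ren_plug ren_up_ren_pctx)

lemma ren_substc_ectx: "ren_ectx \<rho> (substc_ectx k G E) = substc_ectx k (ren_pctx \<rho> G) (ren_ectx \<rho> E)"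
  by (induction E) (simp_all add: ren_substc)

lemma ren_substc_pctx: "ren_pctx \<rho> (substc_pctx k G F) = substc_pctx k (ren_pctx \<rho> G) (ren_pctx \<rho> F)"
  by (cases F) (simp_all add: ren_substc_ectx ren_pcomp)

text \<open>The side condition relates \<open>G\<close>, living above the variables replaced by \<open>\<sigma>\<close>, to the same
  context \<open>F\<close> seen below them; it is the form that survives going under a binder.\<close>

lemma substc_sub:
  "sub_pctx (\<lambda>n. substc_val k F (\<sigma> n)) G = F \<Longrightarrow>
    substc_val k F (sub_val \<sigma> v) = sub_val (\<lambda>n. substc_val k F (\<sigma> n)) (substc_val k G v)"
  "sub_pctx (\<lambda>n. substc_val k F (\<sigma> n)) G = F \<Longrightarrow>
    substc_trm k F (sub_trm \<sigma> t) = sub_trm (\<lambda>n. substc_val k F (\<sigma> n)) (substc_trm k G t)"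
  "sub_pctx (\<lambda>n. substc_val k F (\<sigma> n)) G = F \<Longrightarrow>
    substc_prog k F (sub_prog \<sigma> p) = sub_prog (\<lambda>n. substc_val k F (\<sigma> n)) (substc_prog k G p)"
proof (induction v and t and p arbitrary: F \<sigma> G and F \<sigma> G and F \<sigma> G)
  case (Lam t)
  have up: "(\<lambda>n. substc_val k (ren_pctx Suc F) (up_sub \<sigma> n)) = up_sub (\<lambda>n. substc_val k F (\<sigma> n))"
    by (auto simp: up_sub_def ren_substc split: nat.split)
  have "sub_pctx (\<lambda>n. substc_val k (ren_pctx Suc F) (up_sub \<sigma> n)) (ren_pctx Suc G) = ren_pctx Suc F"
    unfolding up sub_up_ren_pctx Lam.prems ..
  from Lam.IH[OF this] show ?case by (simp add: up)
qed (auto simp: sub_plug)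

text \<open>Instance of \<open>substc_sub\<close>: the instantiating substitution undoes the shift
  of \<open>F\<close>, and context substitution leaves variables alone, so only the value at index 0
  changes.\<close>

lemma substc_inst:
  "substc_trm k F (inst t v) = inst (substc_trm k (ren_pctx Suc F) t) (substc_val k F v)"
proof -
  have \<sigma>: "(\<lambda>n. substc_val k F (case_nat v Var n)) = case_nat (substc_val k F v) Var"
    by (auto split: nat.split)
  show ?thesis
    unfolding inst_def by (subst substc_sub(2)[where G = "ren_pctx Suc F"])
      (simp_all only: \<sigma> sub_ren_pctx nat.case sub_pctx_id)
qed


section \<open>Reduction\<close>

definition decomposable :: "trm \<Rightarrow> bool" where
  "decomposable r \<longleftrightarrow> (\<exists>v w. r = App (Val v) (Val w)) \<or> (\<exists>p. r = Abort p)"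

lemma decomposable_simps [simp]:
  "decomposable (App (Val v) (Val w))" "decomposable (Abort p)" "\<not> decomposable (Val v)"
  by (auto simp: decomposable_def)

lemma eplug_neq_Val: "decomposable r \<Longrightarrow> eplug E r \<noteq> Val v"
  by (cases E) auto

lemma decomposable_eplug: "decomposable r \<Longrightarrow> decomposable (eplug E r) \<Longrightarrow> E = Hole"
  by (cases E) (auto simp: decomposable_def eplug_neq_Val dest: sym)

text \<open>Unique decomposition. If the two contexts start with different constructors, either a
  decomposable term would sit properly inside another one, or a value would be a plugged
  decomposable term.\<close>

lemma eplug_inj:
  assumes "decomposable r" "decomposable s" "eplug E r = eplug E' s"
  shows "E = E' \<and> r = s"
  using assms(3)
proof (induction E arbitrary: E')
  case Hole
  then show ?case using decomposable_eplug[of s E'] assms by auto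
next
  case (ArgC v E)
  show ?case
  proof (cases E')
    case Hole
    then show ?thesis using ArgC.prems assms decomposable_eplug[of r "ArgC v E"] by simp
  next
    case (ArgC w E1)
    then show ?thesis using ArgC.prems ArgC.IH[of E1] by simp
  next
    case (FunC E1 t)
    then show ?thesis using ArgC.prems eplug_neq_Val[OF assms(2), of E1 v] by simp
  qed
next
  case (FunC E t)
  show ?case
  proof (cases E')
    case Hole
    then show ?thesis using FunC.prems assms decomposable_eplug[of r "FunC E t"] by simp
  next
    case (ArgC w E1)
    then show ?thesis using FunC.prems eplug_neq_Val[OF assms(1), of E w] by simp
  next
    case (FunC E1 t)
    then show ?thesis using FunC.prems FunC.IH[of E1] by simp
  qed
qed

lemma plug_inj:
  assumes "decomposable r" "decomposable s" "plug F r = plug F' s"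
  shows "F = F' \<and> r = s"
  using assms by (cases F; cases F') (auto dest: eplug_inj)

lemma trm_decompose:
  obtains (val) v where "t = Val v" | (plug) E r where "t = eplug E r" "decomposable r"
proof -
  \<comment> \<open>The mutual induction carries trivial claims for values and programs, since
    \<open>Abort p\<close> is decomposable whatever \<open>p\<close> is.\<close>
  have True "(\<exists>v. t = Val v) \<or> (\<exists>E r. t = eplug E r \<and> decomposable r)" True for v :: val and p :: prog
  proof (induction v and t and p)
    case (App t s)
    show ?case
    proof (cases "\<exists>v. t = Val v")
      case True
      then obtain v where t: "t = Val v" by blast
      show ?thesis
      proof (cases "\<exists>w. s = Val w")
        case True
        with t have "App t s = eplug Hole (App t s) \<and> decomposable (App t s)" by auto
        then show ?thesis by blast
      next
        case False
        with App.IH(2) obtain E r where "s = eplug E r" "decomposable r" by blast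
        with t have "App t s = eplug (ArgC v E) r \<and> decomposable r" by simp
        then show ?thesis by blast
      qed
    next
      case False
      with App.IH(1) obtain E r where "t = eplug E r" "decomposable r" by blast
      then have "App t s = eplug (FunC E s) r \<and> decomposable r" by simp
      then show ?thesis by blast
    qed
  next
    case (Abort p)
    have "Abort p = eplug Hole (Abort p)" by simp
    then show ?case using decomposable_simps(2) by blast
  qed auto
  with that show ?thesis by blast
qed

text \<open>Contraction keeps the context as a parameter because callcc copies it and abort discards
  it. Separating it from the plugged program lets unique decomposition settle determinism.\<close>

inductive contract :: "pctx \<Rightarrow> trm \<Rightarrow> prog \<Rightarrow> bool" where
  "contract F (App (Val (Lam t)) (Val v)) (plug F (inst t v))"
| "contract F (App (Val Callcc) (Val v))
     (plug F (App (Val v) (Val (Lam (Abort (plug (ren_pctx Suc F) (Val (Var 0))))))))"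
| "contract F (Abort p) p"

lemma contract_decomposable: "contract F r p \<Longrightarrow> decomposable r"
  by (auto elim: contract.cases)

lemma contract_deterministic: "contract F r p \<Longrightarrow> contract F r q \<Longrightarrow> p = q"
  by (auto elim!: contract.cases)

lemma step_iff_contract: "p \<longmapsto> q \<longleftrightarrow> (\<exists>F r. p = plug F r \<and> contract F r q)"
proof
  show "\<exists>F r. p = plug F r \<and> contract F r q" if "p \<longmapsto> q"
    using that by cases (use contract.intros in fast)+
  show "p \<longmapsto> q" if "\<exists>F r. p = plug F r \<and> contract F r q"
    using that by (auto elim!: contract.cases intro: step.intros)
qed

lemma step_plug:
  assumes "decomposable r"
  shows "plug F r \<longmapsto> q \<longleftrightarrow> contract F r q"
  using assms plug_inj contract_decomposable unfolding step_iff_contract by metis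

lemma step_deterministic: "p \<longmapsto> q \<Longrightarrow> p \<longmapsto> q' \<Longrightarrow> q = q'"
  unfolding step_iff_contract using plug_inj contract_decomposable contract_deterministic by metis

lemma stuck_no_step: "\<not> plug F (App (Val (Var x)) (Val v)) \<longmapsto> q"
  by (auto simp: step_plug elim: contract.cases)

lemma plug_neq_Val:
  assumes "decomposable r"
  shows "plug F r \<noteq> Trm (Val v)" "plug F r \<noteq> Nam k (Val v)"
  using assms by (cases F; auto simp: eplug_neq_Val)+

lemma value_no_step: "\<not> Trm (Val v) \<longmapsto> q" "\<not> Nam k (Val v) \<longmapsto> q"
  by (metis step_iff_contract contract_decomposable plug_neq_Val)+

text \<open>These cases match the clauses of a simulation, so later arguments split on the left
  program. An application of values is stuck when its head is a variable; an abstraction or callcc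
  as head gives a redex.\<close>

lemma prog_cases:
  obtains (val) v where "p = Trm (Val v)"
  | (named) k v where "p = Nam k (Val v)"
  | (stuck) F x v where "p = plug F (App (Val (Var x)) (Val v))"
  | (step) p' where "p \<longmapsto> p'"
proof -
  have plugged: thesis if p: "p = plug F r" and r: "decomposable r" for F r
  proof -
    from r consider v w where "r = App (Val v) (Val w)" | q where "r = Abort q"
      unfolding decomposable_def by blast
    then show thesis
    proof cases
      case 1
      show thesis
      proof (cases v)
        case (Var x)
        show thesis by (rule stuck) (simp only: p 1 Var)
      next
        case (Lam t)
        show thesis by (rule step) (simp only: p 1 Lam, rule step_beta)
      next
        case Callcc
        show thesis by (rule step) (simp only: p 1 Callcc, rule step_callcc)
      qed
    next
      case 2
      show thesis by (rule step) (simp only: p 2, rule step_abort)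
    qed
  qed
  show thesis
  proof (cases p)
    case p: (Trm t)
    show thesis
    proof (cases t rule: trm_decompose)
      case (val v)
      show thesis by (rule that(1)) (simp only: p val)
    next
      case (plug E r)
      show thesis by (rule plugged[of "PlainC E" r])
        (simp_all add: p plug)
    qed
  next
    case p: (Nam k t)
    show thesis
    proof (cases t rule: trm_decompose)
      case (val v)
      show thesis by (rule that(2)) (simp only: p val)
    next
      case (plug E r)
      show thesis by (rule plugged[of "NamC k E" r])
        (simp_all add: p plug)
    qed
  qed
qed

text \<open>Values replace variables, so evaluation contexts stay evaluation contexts and redexes
  stay redexes. For callcc, the bound index 0 of the captured continuation is untouched.\<close>

lemma step_sub: "p \<longmapsto> q \<Longrightarrow> sub_prog \<sigma> p \<longmapsto> sub_prog \<sigma> q"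
proof (induction rule: step.induct)
  case (step_beta F t v)
  show ?case by (simp add: sub_plug sub_inst step.step_beta)
next
  case (step_callcc F v)
  have "up_sub \<sigma> 0 = Var 0" by (simp add: up_sub_def)
  then show ?case
    using step.step_callcc[of "sub_pctx \<sigma> F" "sub_val \<sigma> v"] by (simp add: sub_plug sub_up_ren_pctx)
next
  case (step_abort F p)
  show ?case by (simp add: sub_plug step.step_abort)
qed

text \<open>A named context may become a composite one, but it still surrounds the same redex. The
  continuation captured by callcc follows because context substitution commutes with the
  shift.\<close>

lemma step_substc: "p \<longmapsto> q \<Longrightarrow> substc_prog k G p \<longmapsto> substc_prog k G q"
proof (induction rule: step.induct)
  case (step_beta F t v)
  show ?case by (simp add: substc_plug substc_inst step.step_beta)
next
  case (step_callcc F v)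
  show ?case
    using step.step_callcc[of "substc_pctx k G F" "substc_val k G v"]
    by (simp add: substc_plug ren_substc_pctx)
next
  case (step_abort F p)
  show ?case by (simp add: substc_plug step.step_abort)
qed

lemma steps_sub: "p \<longmapsto>* q \<Longrightarrow> sub_prog \<sigma> p \<longmapsto>* sub_prog \<sigma> q"
  by (induction rule: rtranclp_induct) (simp, metis step_sub rtranclp.rtrancl_into_rtrancl)

lemma steps_substc: "p \<longmapsto>* q \<Longrightarrow> substc_prog k G p \<longmapsto>* substc_prog k G q"
  by (induction rule: rtranclp_induct) (simp, metis step_substc rtranclp.rtrancl_into_rtrancl)


section \<open>Relations\<close>

lemma trm_rel_mono: "R \<subseteq> S \<Longrightarrow> trm_rel R \<subseteq> trm_rel S"
  unfolding trm_rel_def by blast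

lemma val_rel_mono: "R \<subseteq> S \<Longrightarrow> val_rel R \<subseteq> val_rel S"
  unfolding val_rel_def by (drule trm_rel_mono) blast

lemma ctx_rel_mono: "R \<subseteq> S \<Longrightarrow> ctx_rel R \<subseteq> ctx_rel S"
  unfolding ctx_rel_def by blast

lemma val_rel_iff:
  "(v, w) \<in> val_rel R \<longleftrightarrow> (\<exists>x k. x \<notin> fv_val v \<union> fv_val w \<and> k \<notin> cv_val v \<union> cv_val w \<and>
     (Nam k (App (Val v) (Val (Var x))), Nam k (App (Val w) (Val (Var x)))) \<in> R)"
  by (simp add: val_rel_def trm_rel_def)

lemma trm_rel_converse: "trm_rel (R\<inverse>) = (trm_rel R)\<inverse>"
  unfolding trm_rel_def by (simp add: set_eq_iff conj_ac)

lemma val_rel_converse: "val_rel (R\<inverse>) = (val_rel R)\<inverse>"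
  unfolding val_rel_def trm_rel_converse by (simp add: set_eq_iff conj_ac)

lemma ctx_rel_converse: "ctx_rel (R\<inverse>) = (ctx_rel R)\<inverse>"
  unfolding ctx_rel_def by (simp add: set_eq_iff conj_ac)

text \<open>Unique decomposition recovers the contexts and arguments from the plugged
  programs.\<close>

lemma open_rel_stuck:
  "(plug F (App (Val (Var x)) (Val v)), plug F' (App (Val (Var x)) (Val w))) \<in> open_rel R
    \<longleftrightarrow> (F, F') \<in> ctx_rel R \<and> (v, w) \<in> val_rel R"
proof
  assume "(plug F (App (Val (Var x)) (Val v)), plug F' (App (Val (Var x)) (Val w))) \<in> open_rel R"
  then obtain G G' y v' w' where
    eq: "plug F (App (Val (Var x)) (Val v)) = plug G (App (Val (Var y)) (Val v'))"
      "plug F' (App (Val (Var x)) (Val w)) = plug G' (App (Val (Var y)) (Val w'))"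
    and rel: "(G, G') \<in> ctx_rel R" "(v', w') \<in> val_rel R"
    unfolding open_rel_def by blast
  from plug_inj[OF _ _ eq(1)] plug_inj[OF _ _ eq(2)] rel
  show "(F, F') \<in> ctx_rel R \<and> (v, w) \<in> val_rel R" by simp
next
  assume "(F, F') \<in> ctx_rel R \<and> (v, w) \<in> val_rel R"
  then show "(plug F (App (Val (Var x)) (Val v)), plug F' (App (Val (Var x)) (Val w))) \<in> open_rel R"
    unfolding open_rel_def by blast
qed


section \<open>Closed relations\<close>

definition substitutive :: "prel \<Rightarrow> bool" where
  "substitutive X \<longleftrightarrow> ut_refl X \<subseteq> X \<and> ut_substv X \<subseteq> X"

lemma refl_substitutive: "substitutive X \<Longrightarrow> (p, p) \<in> X"
  by (auto simp: substitutive_def ut_refl_def)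

lemma substv_substitutive:
  "substitutive X \<Longrightarrow> (p, q) \<in> X \<Longrightarrow> (v, w) \<in> val_rel X \<Longrightarrow>
    (sub_prog (Var(x := v)) p, sub_prog (Var(x := w)) q) \<in> X"
  unfolding substitutive_def ut_substv_def substv_prog_def by blast

lemma val_rel_refl:
  assumes "substitutive X"
  shows "(v, v) \<in> val_rel X"
proof -
  from ex_fresh obtain x where "x \<notin> fv_val v" using finite_fv by blast
  moreover from ex_fresh obtain k where "k \<notin> cv_val v" using finite_cv by blast
  ultimately show ?thesis using refl_substitutive[OF assms] by (auto simp: val_rel_iff)
qed

lemma ctx_rel_refl:
  assumes "substitutive X"
  shows "(F, F) \<in> ctx_rel X"
proof -
  from ex_fresh obtain x where "x \<notin> fv_pctx F" using finite_fv_pctx by blast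
  then show ?thesis using refl_substitutive[OF assms] by (auto simp: ctx_rel_def)
qed

text \<open>The names \<open>k\<close> and \<open>x\<close> witnessing \<open>(v, w) \<in> val_rel X\<close> can be changed without renaming \<open>k\<close>:
  substitute \<open>v\<close> and \<open>w\<close> for \<open>y\<close> in the program \<open>k (y x)\<close>, which is related to itself.\<close>

lemma val_rel_all:
  assumes "substitutive X" "(v, w) \<in> val_rel X"
  shows "(Nam k (App (Val v) (Val (Var x))), Nam k (App (Val w) (Val (Var x)))) \<in> X"
  using substv_substitutive[OF assms(1) refl_substitutive[OF assms(1)] assms(2),
      where x = "Suc x" and p = "Nam k (App (Val (Var (Suc x))) (Val (Var x)))"] by simp

text \<open>The variable \<open>x\<close> is related to itself, so it may be substituted for the
  fresh witness.\<close>

lemma ctx_rel_all: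
  assumes "substitutive X" "(F, F') \<in> ctx_rel X"
  shows "(plug F (Val (Var x)), plug F' (Val (Var x))) \<in> X"
proof -
  from assms(2) obtain y where y: "y \<notin> fv_pctx F" "y \<notin> fv_pctx F'"
    and rel: "(plug F (Val (Var y)), plug F' (Val (Var y))) \<in> X"
    by (auto simp: ctx_rel_def)
  from substv_substitutive[OF assms(1) rel val_rel_refl[OF assms(1)], of y "Var x"] y
  show ?thesis by (simp add: sub_plug)
qed

lemma val_rel_sub:
  assumes X: "substitutive X" and vw: "(v, w) \<in> val_rel X" and rr': "(r, r') \<in> val_rel X"
  shows "(sub_val (Var(x := r)) v, sub_val (Var(x := r')) w) \<in> val_rel X"
proof -
  \<comment> \<open>Freshness is required of the substituted values, where the witness is needed;
    \<open>y\<close> must also differ from \<open>x\<close> so that the argument survives the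
    substitution.\<close>
  from ex_fresh obtain y
    where y: "y \<notin> insert x (fv_val (sub_val (Var(x := r)) v) \<union> fv_val (sub_val (Var(x := r')) w))"
    by (metis finite_fv(1) finite_UnI finite_insert)
  from ex_fresh obtain k
    where k: "k \<notin> cv_val (sub_val (Var(x := r)) v) \<union> cv_val (sub_val (Var(x := r')) w)"
    by (metis finite_cv(1) finite_UnI)
  from substv_substitutive[OF X val_rel_all[OF X vw, of k y] rr', of x] y k
  show ?thesis unfolding val_rel_iff by (intro exI[of _ y] exI[of _ k]) simp
qed

lemma ctx_rel_sub:
  assumes X: "substitutive X" and FF': "(F, F') \<in> ctx_rel X" and rr': "(r, r') \<in> val_rel X"
  shows "(sub_pctx (Var(x := r)) F, sub_pctx (Var(x := r')) F') \<in> ctx_rel X"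
proof -
  from ex_fresh obtain y
    where y: "y \<notin> insert x (fv_pctx (sub_pctx (Var(x := r)) F) \<union> fv_pctx (sub_pctx (Var(x := r')) F'))"
    by (metis finite_fv_pctx finite_UnI finite_insert)
  from substv_substitutive[OF X ctx_rel_all[OF X FF', of y] rr', of x] y
  show ?thesis unfolding ctx_rel_def by (auto simp: sub_plug)
qed

text \<open>Applied under a name \<open>j\<close> other than \<open>k\<close>, the values are hit by
  the context substitution while the outer name stays. The result lies in
  \<open>ut_substc X\<close>, as \<open>X\<close> is assumed closed only under
  \<open>ut_refl\<close> and \<open>ut_substv\<close>.\<close>

lemma val_rel_substc:
  assumes X: "substitutive X" and vw: "(v, w) \<in> val_rel X" and FF': "(F, F') \<in> ctx_rel X"
  shows "(substc_val k F v, substc_val k F' w) \<in> val_rel (ut_substc X)"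
proof -
  from ex_fresh obtain y where y: "y \<notin> fv_val (substc_val k F v) \<union> fv_val (substc_val k F' w)"
    by (metis finite_fv(1) finite_UnI)
  from ex_fresh obtain j where j: "j \<notin> insert k (cv_val (substc_val k F v) \<union> cv_val (substc_val k F' w))"
    by (metis finite_cv(1) finite_UnI finite_insert)
  have "(substc_prog k F (Nam j (App (Val v) (Val (Var y)))),
         substc_prog k F' (Nam j (App (Val w) (Val (Var y))))) \<in> ut_substc X"
    using val_rel_all[OF X vw, of j y] FF' unfolding ut_substc_def by blast
  with y j show ?thesis unfolding val_rel_iff by (intro exI[of _ y] exI[of _ j]) simp
qed

lemma ctx_rel_substc:
  assumes X: "substitutive X" and GG': "(G, G') \<in> ctx_rel X" and FF': "(F, F') \<in> ctx_rel X"
  shows "(substc_pctx k F G, substc_pctx k F' G') \<in> ctx_rel (ut_substc X)"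
proof -
  from ex_fresh obtain y where y: "y \<notin> fv_pctx (substc_pctx k F G) \<union> fv_pctx (substc_pctx k F' G')"
    by (metis finite_fv_pctx finite_UnI)
  have "(substc_prog k F (plug G (Val (Var y))), substc_prog k F' (plug G' (Val (Var y)))) \<in> ut_substc X"
    using ctx_rel_all[OF X GG', of y] FF' unfolding ut_substc_def by blast
  with y show ?thesis unfolding ctx_rel_def by (auto simp: substc_plug)
qed


section \<open>Simulation clauses for a pair of programs\<close>

text \<open>The clauses for a single pair, with evaluation replaced by reduction, as the target
  forms are irreducible, and with the extension to open stuck programs split into its
  components.\<close>

definition sim_pair :: "prel \<Rightarrow> prel \<Rightarrow> prog \<Rightarrow> prog \<Rightarrow> bool" where
  "sim_pair S T p q \<longleftrightarrow>
     (\<forall>p'. p \<longmapsto> p' \<longrightarrow> (\<exists>q'. q \<longmapsto>* q' \<and> (p', q') \<in> T)) \<and>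
     (\<forall>v. p = Trm (Val v) \<longrightarrow> (\<exists>w. q \<longmapsto>* Trm (Val w))) \<and>
     (\<forall>F x v. p = plug F (App (Val (Var x)) (Val v)) \<longrightarrow>
        (\<exists>F' w. q \<longmapsto>* plug F' (App (Val (Var x)) (Val w)) \<and> (F, F') \<in> ctx_rel T \<and> (v, w) \<in> val_rel T)) \<and>
     (\<forall>k v. p = Nam k (Val v) \<longrightarrow> (\<exists>w. q \<longmapsto>* Nam k (Val w) \<and> (v, w) \<in> val_rel S))"

lemma evaluates_value [simp]:
  "p \<Down> Trm (Val v) \<longleftrightarrow> p \<longmapsto>* Trm (Val v)"
  "p \<Down> Nam k (Val v) \<longleftrightarrow> p \<longmapsto>* Nam k (Val v)"
  "p \<Down> plug F (App (Val (Var x)) (Val v)) \<longleftrightarrow> p \<longmapsto>* plug F (App (Val (Var x)) (Val v))"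
  by (simp_all add: evaluates_def value_no_step stuck_no_step)

lemma simulates_iff: "simulates R S T \<longleftrightarrow> (\<forall>p q. (p, q) \<in> R \<longrightarrow> sim_pair S T p q)"
  by (simp add: simulates_def sim_pair_def open_rel_stuck)

text \<open>Determinism makes one answer enough, and a program that steps is neither a value, nor a
  named value, nor stuck, so the other clauses are vacuous.\<close>

lemma sim_pair_stepI:
  assumes "p \<longmapsto> p'" "q \<longmapsto>* q'" "(p', q') \<in> T"
  shows "sim_pair S T p q"
  using assms step_deterministic[OF assms(1)] value_no_step stuck_no_step
  unfolding sim_pair_def by metis

lemma sim_pair_valueI:
  assumes "q \<longmapsto>* Trm (Val w)"
  shows "sim_pair S T (Trm (Val v)) q"
  using assms value_no_step plug_neq_Val(1)[OF decomposable_simps(1)]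
  unfolding sim_pair_def by (metis prog.distinct(1))

lemma sim_pair_namedI:
  assumes "q \<longmapsto>* Nam k (Val w)" "(v, w) \<in> val_rel S"
  shows "sim_pair S T (Nam k (Val v)) q"
  using assms value_no_step plug_neq_Val(2)[OF decomposable_simps(1)]
  unfolding sim_pair_def by (metis prog.distinct(1) prog.inject(2) trm.inject(1))

lemma sim_pair_stuckI:
  assumes "q \<longmapsto>* plug F' (App (Val (Var x)) (Val w))" "(F, F') \<in> ctx_rel T" "(v, w) \<in> val_rel T"
  shows "sim_pair S T (plug F (App (Val (Var x)) (Val v))) q"
proof -
  have "F = G \<and> x = y \<and> v = r"
    if "plug F (App (Val (Var x)) (Val v)) = plug G (App (Val (Var y)) (Val r))" for G y r
    using plug_inj[OF _ _ that] by simp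
  with assms show ?thesis
    unfolding sim_pair_def by (metis stuck_no_step plug_neq_Val decomposable_simps(1))
qed

lemma sim_pair_stepE:
  assumes "sim_pair S T p q" "p \<longmapsto> p'"
  obtains q' where "q \<longmapsto>* q'" "(p', q') \<in> T"
  using assms by (auto simp: sim_pair_def)

lemma sim_pair_valueE:
  assumes "sim_pair S T (Trm (Val v)) q"
  obtains w where "q \<longmapsto>* Trm (Val w)"
  using assms by (auto simp: sim_pair_def)

lemma sim_pair_namedE:
  assumes "sim_pair S T (Nam k (Val v)) q"
  obtains w where "q \<longmapsto>* Nam k (Val w)" "(v, w) \<in> val_rel S"
  using assms by (auto simp: sim_pair_def)

lemma sim_pair_stuckE:
  assumes "sim_pair S T (plug F (App (Val (Var x)) (Val v))) q"
  obtains F' w where "q \<longmapsto>* plug F' (App (Val (Var x)) (Val w))"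
    "(F, F') \<in> ctx_rel T" "(v, w) \<in> val_rel T"
  using assms unfolding sim_pair_def by blast

text \<open>Every answer is given by reduction on the right, so initial steps there can be
  prepended; the relations occur only positively.\<close>

lemma sim_pair_weaken:
  assumes sim: "sim_pair S T p q'" and q: "q \<longmapsto>* q'" and "S \<subseteq> S'" "T \<subseteq> T'"
  shows "sim_pair S' T' p q"
proof -
  note sub = val_rel_mono[OF assms(3)] val_rel_mono[OF assms(4)] ctx_rel_mono[OF assms(4)]
  show ?thesis
  proof (cases p rule: prog_cases)
    case (val v)
    from sim obtain w where "q' \<longmapsto>* Trm (Val w)" unfolding val by (rule sim_pair_valueE)
    with q show ?thesis unfolding val by (intro sim_pair_valueI) (rule rtranclp_trans)
  next
    case (named k v)
    from sim obtain w where w: "q' \<longmapsto>* Nam k (Val w)" "(v, w) \<in> val_rel S"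
      unfolding named by (rule sim_pair_namedE)
    from sim_pair_namedI[OF rtranclp_trans[OF q w(1)]] w(2) sub show ?thesis unfolding named by blast
  next
    case (stuck F x v)
    from sim obtain F' w where w: "q' \<longmapsto>* plug F' (App (Val (Var x)) (Val w))"
      "(F, F') \<in> ctx_rel T" "(v, w) \<in> val_rel T"
      unfolding stuck by (rule sim_pair_stuckE)
    from sim_pair_stuckI[OF rtranclp_trans[OF q w(1)]] w(2,3) sub show ?thesis unfolding stuck by blast
  next
    case (step p')
    from sim_pair_stepE[OF sim step] obtain q'' where q'': "q' \<longmapsto>* q''" "(p', q'') \<in> T" .
    from sim_pair_stepI[OF step rtranclp_trans[OF q q''(1)]] q''(2) assms(4) show ?thesis by blast
  qed
qed

lemma sim_pair_mono: "sim_pair S T p q \<Longrightarrow> S \<subseteq> S' \<Longrightarrow> T \<subseteq> T' \<Longrightarrow> sim_pair S' T' p q"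
  by (rule sim_pair_weaken[OF _ rtranclp.rtrancl_refl])

lemma sim_pair_steps_right: "sim_pair S T p q' \<Longrightarrow> q \<longmapsto>* q' \<Longrightarrow> sim_pair S T p q"
  by (rule sim_pair_weaken[OF _ _ order_refl order_refl])

text \<open>The parameter \<open>S\<close> is irrelevant: the plugged applications are never of the form \<open>k v\<close>.\<close>

definition active :: "prel \<Rightarrow> val \<Rightarrow> val \<Rightarrow> bool" where
  "active Y v w \<longleftrightarrow> (\<forall>S F F' r r'. (F, F') \<in> ctx_rel Y \<longrightarrow> (r, r') \<in> val_rel Y \<longrightarrow>
     sim_pair S Y (plug F (App (Val v) (Val r))) (plug F' (App (Val w) (Val r'))))"

text \<open>Substitution preserves the form of the left program except when it is stuck with head
  \<open>x\<close>; there activity of the values answers. The named clause is left as a hypothesis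
  because \<open>S\<close> need not be closed under substitution.\<close>

lemma sim_pair_sub:
  assumes Y: "substitutive Y" and sim: "sim_pair S Y p q" and vw: "(v, w) \<in> val_rel Y"
    and head: "\<And>F r. p = plug F (App (Val (Var x)) (Val r)) \<Longrightarrow> active Y v w"
    and named: "\<And>k r r'. p = Nam k (Val r) \<Longrightarrow> (r, r') \<in> val_rel S \<Longrightarrow>
      (sub_val (Var(x := v)) r, sub_val (Var(x := w)) r') \<in> val_rel X"
  shows "sim_pair X Y (sub_prog (Var(x := v)) p) (sub_prog (Var(x := w)) q)"
proof (cases p rule: prog_cases)
  case (val r)
  with sim obtain r' where "q \<longmapsto>* Trm (Val r')" by (blast elim: sim_pair_valueE)
  from steps_sub[OF this, of "Var(x := w)"] val show ?thesis by (auto intro: sim_pair_valueI)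
next
  case (named k r)
  with sim obtain r' where "q \<longmapsto>* Nam k (Val r')" "(r, r') \<in> val_rel S"
    by (blast elim: sim_pair_namedE)
  with steps_sub[OF this(1), of "Var(x := w)"] assms(5)[OF named] named show ?thesis
    by (auto intro: sim_pair_namedI)
next
  case (stuck F y r)
  with sim obtain F' r' where q: "q \<longmapsto>* plug F' (App (Val (Var y)) (Val r'))"
    and FF': "(F, F') \<in> ctx_rel Y" and rr': "(r, r') \<in> val_rel Y"
    by (blast elim: sim_pair_stuckE)
  note q' = steps_sub[OF q, of "Var(x := w)", unfolded sub_plug]
  note F = ctx_rel_sub[OF Y FF' vw, of x] and r = val_rel_sub[OF Y rr' vw, of x]
  show ?thesis
  proof (cases "y = x")
    case True
    with head stuck have "active Y v w" by blast
    with F r have "sim_pair X Y (sub_prog (Var(x := v)) p)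
        (sub_prog (Var(x := w)) (plug F' (App (Val (Var y)) (Val r'))))"
      unfolding active_def by (simp add: stuck sub_plug True)
    then show ?thesis using steps_sub[OF q] by (rule sim_pair_steps_right)
  next
    case False
    with q' F r show ?thesis by (auto simp: stuck sub_plug intro: sim_pair_stuckI)
  qed
next
  case (step p')
  with sim obtain q' where "q \<longmapsto>* q'" "(p', q') \<in> Y" by (blast elim: sim_pair_stepE)
  then show ?thesis
    using sim_pair_stepI[OF step_sub[OF step] steps_sub] substv_substitutive[OF Y _ vw] by blast
qed

text \<open>Only a value named by \<open>k\<close> can change form. Reduction and stuck programs
  produce obligations in \<open>Y\<close>, which absorbs \<open>ut_substc\<close>; named values
  remain as hypotheses, since \<open>X\<close> need not absorb it.\<close>

lemma sim_pair_substc: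
  assumes Y: "substitutive Y" "ut_substc Y \<subseteq> Y" and sim: "sim_pair S Y p q"
    and FF': "(F, F') \<in> ctx_rel Y"
    and same: "\<And>r r'. p = Nam k (Val r) \<Longrightarrow> (r, r') \<in> val_rel S \<Longrightarrow>
      sim_pair X Y (plug F (Val (substc_val k F r))) (plug F' (Val (substc_val k F' r')))"
    and other: "\<And>j r r'. p = Nam j (Val r) \<Longrightarrow> (r, r') \<in> val_rel S \<Longrightarrow> j \<noteq> k \<Longrightarrow>
      (substc_val k F r, substc_val k F' r') \<in> val_rel X"
  shows "sim_pair X Y (substc_prog k F p) (substc_prog k F' q)"
proof (cases p rule: prog_cases)
  case (val r)
  with sim obtain r' where "q \<longmapsto>* Trm (Val r')" by (blast elim: sim_pair_valueE)
  from steps_substc[OF this, of k F'] val show ?thesis by (auto intro: sim_pair_valueI)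
next
  case (named j r)
  with sim obtain r' where q: "q \<longmapsto>* Nam j (Val r')" and rr': "(r, r') \<in> val_rel S"
    by (blast elim: sim_pair_namedE)
  note q' = steps_substc[OF q, of k F']
  show ?thesis
  proof (cases "j = k")
    case True
    with same[OF _ rr'] q' named show ?thesis by (auto intro: sim_pair_steps_right)
  next
    case False
    with other[OF named rr'] q' named show ?thesis by (auto intro: sim_pair_namedI)
  qed
next
  case (stuck G x r)
  with sim obtain G' r' where q: "q \<longmapsto>* plug G' (App (Val (Var x)) (Val r'))"
    and GG': "(G, G') \<in> ctx_rel Y" and rr': "(r, r') \<in> val_rel Y"
    by (blast elim: sim_pair_stuckE)
  have "(substc_pctx k F G, substc_pctx k F' G') \<in> ctx_rel Y"
    using ctx_rel_substc[OF Y(1) GG' FF'] ctx_rel_mono[OF Y(2)] by blast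
  moreover have "(substc_val k F r, substc_val k F' r') \<in> val_rel Y"
    using val_rel_substc[OF Y(1) rr' FF'] val_rel_mono[OF Y(2)] by blast
  ultimately show ?thesis
    using steps_substc[OF q, of k F'] by (auto simp: stuck substc_plug intro: sim_pair_stuckI)
next
  case (step p')
  with sim obtain q' where q': "q \<longmapsto>* q'" "(p', q') \<in> Y" by (blast elim: sim_pair_stepE)
  with FF' have "(substc_prog k F p', substc_prog k F' q') \<in> Y"
    using Y(2) unfolding ut_substc_def by blast
  then show ?thesis using sim_pair_stepI[OF step_substc[OF step] steps_substc[OF q'(1)]] by blast
qed

text \<open>One game on \<open>k (v x)\<close> generates all instances: rename \<open>x\<close> to a
  variable fresh for the contexts too, substitute the contexts for \<open>k\<close>, then the
  arguments for that variable. No program along the way is a named value, so the passive clause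
  never applies.\<close>

lemma activeI:
  assumes Y: "substitutive Y" "ut_substc Y \<subseteq> Y"
    and x: "x \<notin> fv_val v \<union> fv_val w" and k: "k \<notin> cv_val v \<union> cv_val w"
    and sim: "sim_pair S Y (Nam k (App (Val v) (Val (Var x)))) (Nam k (App (Val w) (Val (Var x))))"
  shows "active Y v w"
  unfolding active_def
proof (intro allI impI)
  fix S' F F' r r'
  assume FF': "(F, F') \<in> ctx_rel Y" and rr': "(r, r') \<in> val_rel Y"
  from ex_fresh obtain y where y: "y \<notin> fv_val v \<union> fv_val w \<union> fv_pctx F \<union> fv_pctx F'"
    by (metis finite_fv(1) finite_fv_pctx finite_UnI)
  \<comment> \<open>A plugged application of \<open>v\<close> is stuck only if \<open>v\<close> is
    its head variable. Freshness of the argument variable thus rules out the active case in both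
    variable substitutions.\<close>
  have head: "v = Var z" if "plug G (App (Val v) (Val s)) = plug G' (App (Val (Var z)) (Val s'))"
    for G G' s s' z
    using plug_inj[OF _ _ that] by simp
  have "sim_pair S Y (sub_prog (Var(x := Var y)) (Nam k (App (Val v) (Val (Var x)))))
      (sub_prog (Var(x := Var y)) (Nam k (App (Val w) (Val (Var x)))))"
  proof (rule sim_pair_sub[OF Y(1) sim val_rel_refl[OF Y(1)]])
    show "active Y (Var y) (Var y)"
      if "Nam k (App (Val v) (Val (Var x))) = plug G (App (Val (Var x)) (Val s))" for G s
      using x head[of "NamC k Hole" "Var x" G x s] that by simp
  qed simp
  with x have "sim_pair S Y (Nam k (App (Val v) (Val (Var y)))) (Nam k (App (Val w) (Val (Var y))))"
    by simp
  then have "sim_pair S Y (substc_prog k F (Nam k (App (Val v) (Val (Var y)))))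
      (substc_prog k F' (Nam k (App (Val w) (Val (Var y)))))"
    by (rule sim_pair_substc[OF Y]) (use FF' in auto)
  with k have "sim_pair S Y (plug F (App (Val v) (Val (Var y)))) (plug F' (App (Val w) (Val (Var y))))"
    by simp
  \<comment> \<open>The passive relation can switch from \<open>S\<close> to an arbitrary
    \<open>S'\<close> because a plugged application is never a named value.\<close>
  then have "sim_pair S' Y (sub_prog (Var(y := r)) (plug F (App (Val v) (Val (Var y)))))
      (sub_prog (Var(y := r')) (plug F' (App (Val w) (Val (Var y)))))"
  proof (rule sim_pair_sub[OF Y(1) _ rr'])
    show "active Y r r'"
      if "plug F (App (Val v) (Val (Var y))) = plug G (App (Val (Var y)) (Val s))" for G s
      using y head[OF that] by auto
    show "(sub_val (Var(y := r)) s, sub_val (Var(y := r')) s') \<in> val_rel S'"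
      if "plug F (App (Val v) (Val (Var y))) = Nam j (Val s)" for j s s'
      using that by (simp add: plug_neq_Val)
  qed
  with y show "sim_pair S' Y (plug F (App (Val v) (Val r))) (plug F' (App (Val w) (Val r')))"
    by (simp add: sub_plug)
qed

lemma active_val_rel:
  assumes "substitutive Y" "ut_substc Y \<subseteq> Y" "simulates R S Y" "(v, w) \<in> val_rel R"
  shows "active Y v w"
  using assms(3,4) activeI[OF assms(1,2)] unfolding val_rel_iff simulates_iff by blast

text \<open>Play the game on \<open>j (v y)\<close> with \<open>j\<close> different from
  \<open>k\<close>: the context substitution leaves \<open>j\<close> in place, and
  \<open>activeI\<close> rebuilds activity from the resulting pair.\<close>

lemma active_substc:
  assumes Y: "substitutive Y" "ut_substc Y \<subseteq> Y"
    and vw: "active Y v w" and FF': "(F, F') \<in> ctx_rel Y"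
  shows "active Y (substc_val k F v) (substc_val k F' w)"
proof -
  from ex_fresh obtain y where y: "y \<notin> fv_val (substc_val k F v) \<union> fv_val (substc_val k F' w)"
    by (metis finite_fv(1) finite_UnI)
  from ex_fresh obtain j where j: "j \<notin> insert k (cv_val (substc_val k F v) \<union> cv_val (substc_val k F' w))"
    by (metis finite_cv(1) finite_UnI finite_insert)
  have "sim_pair {} Y (plug (NamC j Hole) (App (Val v) (Val (Var y))))
      (plug (NamC j Hole) (App (Val w) (Val (Var y))))"
    using vw ctx_rel_refl[OF Y(1)] val_rel_refl[OF Y(1)] unfolding active_def by blast
  then have "sim_pair {} Y (substc_prog k F (plug (NamC j Hole) (App (Val v) (Val (Var y)))))
      (substc_prog k F' (plug (NamC j Hole) (App (Val w) (Val (Var y)))))"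
    by (rule sim_pair_substc[OF Y]) (use FF' in auto)
  with j y show ?thesis by (intro activeI[OF Y, of y _ _ j]) auto
qed


section \<open>Evolution of the up-to techniques\<close>

definition closed :: "(prel \<Rightarrow> prel) set \<Rightarrow> prel \<Rightarrow> bool" where
  "closed G X \<longleftrightarrow> (\<forall>g\<in>G. g X \<subseteq> X)"

abbreviation strong_uts :: "(prel \<Rightarrow> prel) set" where
  "strong_uts \<equiv> {ut_refl, ut_result, ut_abort, ut_lam, ut_substv, ut_red}"

abbreviation all_uts :: "(prel \<Rightarrow> prel) set" where
  "all_uts \<equiv> {ut_refl, ut_result, ut_abort, ut_lam, ut_substv, ut_substc, ut_red}"

lemma closed_substitutive: "closed strong_uts X \<Longrightarrow> substitutive X"
  by (simp add: closed_def substitutive_def)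

lemma simulates_refl:
  assumes "substitutive X" "substitutive Y"
  shows "simulates (ut_refl R) X Y"
proof -
  have "sim_pair X Y p p" for p
    using ctx_rel_refl[OF assms(2)] val_rel_refl[OF assms(2)] val_rel_refl[OF assms(1)]
      refl_substitutive[OF assms(2)]
    unfolding sim_pair_def by blast
  then show ?thesis by (auto simp: simulates_iff ut_refl_def)
qed

lemma simulates_result: "simulates (ut_result R) X Y"
  by (auto simp: simulates_iff ut_result_def intro: sim_pair_valueI)

lemma simulates_abort:
  assumes "R \<subseteq> Y"
  shows "simulates (ut_abort R) X Y"
proof -
  have "Nam k (Abort p) \<longmapsto> p" for k p using step_abort[of "NamC k Hole"] by simp
  then have "sim_pair X Y (Nam k (Abort p)) (Nam k (Abort q))" if "(p, q) \<in> R" for k p q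
    using that assms by (intro sim_pair_stepI[of _ p _ q]) auto
  then show ?thesis unfolding simulates_iff ut_abort_def by blast
qed

text \<open>Applying both abstractions to a variable and reducing gives back the bodies, so closure
  under \<open>ut_red\<close> relates the abstractions already in the passive relation.\<close>

lemma simulates_lam:
  assumes red: "ut_red X \<subseteq> X" and "R \<subseteq> X"
  shows "simulates (ut_lam R) X Y"
proof -
  have "(lambda x t, lambda x s) \<in> val_rel X" if "(t, s) \<in> trm_rel R" for x t s
  proof -
    from that obtain k where k: "k \<notin> cv_trm t \<union> cv_trm s" and R: "(Nam k t, Nam k s) \<in> R"
      by (auto simp: trm_rel_def)
    \<comment> \<open>The bound name \<open>x\<close> itself serves as the fresh argument: it is not
      free in the abstraction, and the beta step returns the body unchanged.\<close>
    have "Nam k (App (Val (lambda x u)) (Val (Var x))) \<longmapsto> Nam k u" for u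
    proof -
      have "inst (ren_trm (bind_var x) u) (Var x) = u"
        using inst_lambda[OF lambda_def] by (simp add: substv_trm_def)
      then show ?thesis
        using step_beta[of "NamC k Hole" "ren_trm (bind_var x) u" "Var x"] by (simp add: lambda_def)
    qed
    then have "(Nam k (App (Val (lambda x t)) (Val (Var x))), Nam k (App (Val (lambda x s)) (Val (Var x)))) \<in> ut_red X"
      using R assms(2) unfolding ut_red_def by blast
    with red k show ?thesis
      unfolding val_rel_iff by (intro exI[of _ x] exI[of _ k]) (auto simp: lambda_fresh)
  qed
  then show ?thesis by (auto simp: simulates_iff ut_lam_def intro: sim_pair_namedI)
qed

lemma simulates_red:
  assumes R: "simulates R X Y" "R \<subseteq> Y" and red: "ut_red Y \<subseteq> Y"
  shows "simulates (ut_red R) X Y"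
  unfolding simulates_iff
proof (intro allI impI)
  fix p q assume "(p, q) \<in> ut_red R"
  then obtain p' q' where p: "p \<longmapsto>* p'" and q: "q \<longmapsto>* q'" and pq: "(p', q') \<in> R"
    by (auto simp: ut_red_def)
  from p show "sim_pair X Y p q"
  proof (cases rule: converse_rtranclpE)
    case base
    with R(1) pq q show ?thesis by (auto simp: simulates_iff intro: sim_pair_steps_right)
  next
    case (step p1)
    \<comment> \<open>The right program answers the first left step with no step; what remains of
      the left reduction still leads to \<open>p'\<close>.\<close>
    with q pq R(2) have "(p1, q) \<in> ut_red Y" unfolding ut_red_def by blast
    with red step(1) show ?thesis by (blast intro: sim_pair_stepI)
  qed
qed

text \<open>The substituted values come from \<open>R\<close>, which plays the game, so they are
  active; the values in a passive named pair are handled by closure of \<open>X\<close> under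
  \<open>ut_substv\<close>.\<close>

lemma simulates_substv:
  assumes X: "substitutive X" and Y: "substitutive Y" "ut_substc Y \<subseteq> Y"
    and R: "simulates R S Y" "R \<subseteq> S" "S \<subseteq> X" "X \<subseteq> Y"
  shows "simulates (ut_substv R) X Y"
  unfolding simulates_iff
proof (intro allI impI)
  fix p' q' assume "(p', q') \<in> ut_substv R"
  then obtain x v w p q where
    eq: "p' = sub_prog (Var(x := v)) p" "q' = sub_prog (Var(x := w)) q"
    and pq: "(p, q) \<in> R" and vw: "(v, w) \<in> val_rel R"
    unfolding ut_substv_def substv_prog_def by blast
  from vw R have vwX: "(v, w) \<in> val_rel X" using val_rel_mono[of R X] by blast
  show "sim_pair X Y p' q'"
    unfolding eq
  proof (rule sim_pair_sub[OF Y(1)])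
    show "sim_pair S Y p q" using R(1) pq by (auto simp: simulates_iff)
    show "(v, w) \<in> val_rel Y" using vwX val_rel_mono[OF R(4)] by blast
    show "active Y v w" by (rule active_val_rel[OF Y R(1) vw])
    show "(sub_val (Var(x := v)) r, sub_val (Var(x := w)) r') \<in> val_rel X"
      if "(r, r') \<in> val_rel S" for r r'
      using that val_rel_mono[OF R(3)] val_rel_sub[OF X _ vwX] by blast
  qed
qed

text \<open>Plugging \<open>k r\<close>, with \<open>r\<close> related only passively, may expose a named value again; its
  values then need a substitution performed after \<open>ut_substc\<close>, whence the two closures
  \<open>X0\<close> and \<open>X\<close> around one application of \<open>ut_substc\<close>.\<close>

lemma simulates_substc:
  assumes X0: "substitutive X0" and X: "substitutive X"
    and Y: "substitutive Y" "ut_substc Y \<subseteq> Y"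
    and R: "simulates R R Y" "R \<subseteq> X0" "X0 \<subseteq> X" "ut_substc X0 \<subseteq> X" "X \<subseteq> Y"
  shows "simulates (ut_substc R) X Y"
  unfolding simulates_iff
proof (intro allI impI)
  fix p' q' assume "(p', q') \<in> ut_substc R"
  then obtain k F F' p q where eq: "p' = substc_prog k F p" "q' = substc_prog k F' q"
    and pq: "(p, q) \<in> R" and FF': "(F, F') \<in> ctx_rel R"
    unfolding ut_substc_def by blast
  have F0: "(F, F') \<in> ctx_rel X0" using FF' ctx_rel_mono[OF R(2)] by blast
  then have FY: "(F, F') \<in> ctx_rel Y" using ctx_rel_mono[of X0 Y] R(3,5) by blast
  have valX: "(substc_val k F r, substc_val k F' r') \<in> val_rel X" if "(r, r') \<in> val_rel R" for r r'
    using val_rel_substc[OF X0 _ F0] that val_rel_mono[OF R(2)] val_rel_mono[OF R(4)] by blast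
  show "sim_pair X Y p' q'"
    unfolding eq
  proof (rule sim_pair_substc[OF Y _ FY])
    show "sim_pair R Y p q" using R(1) pq by (auto simp: simulates_iff)
    show "(substc_val k F r, substc_val k F' r') \<in> val_rel X" if "(r, r') \<in> val_rel R" for r r'
      by (rule valX[OF that])
    show "sim_pair X Y (plug F (Val (substc_val k F r))) (plug F' (Val (substc_val k F' r')))"
      if rr': "(r, r') \<in> val_rel R" for r r'
    proof -
      let ?v = "substc_val k F r" and ?w = "substc_val k F' r'"
      from FF' obtain x where x: "x \<notin> fv_pctx F" "x \<notin> fv_pctx F'"
        and rel: "(plug F (Val (Var x)), plug F' (Val (Var x))) \<in> R"
        by (auto simp: ctx_rel_def)
      have "sim_pair X Y (sub_prog (Var(x := ?v)) (plug F (Val (Var x))))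
          (sub_prog (Var(x := ?w)) (plug F' (Val (Var x))))"
      proof (rule sim_pair_sub[OF Y(1)])
        show "sim_pair R Y (plug F (Val (Var x))) (plug F' (Val (Var x)))"
          using R(1) rel by (auto simp: simulates_iff)
        show "(?v, ?w) \<in> val_rel Y" using valX[OF rr'] val_rel_mono[OF R(5)] by blast
        \<comment> \<open>This is where \<open>R\<close> progressing passively to itself matters:
          the named values are related through \<open>R\<close>, hence play the game and are
          active.\<close>
        show "active Y ?v ?w"
          by (rule active_substc[OF Y active_val_rel[OF Y R(1) rr'] FY])
        show "(sub_val (Var(x := ?v)) s, sub_val (Var(x := ?w)) s') \<in> val_rel X"
          if "(s, s') \<in> val_rel R" for s s'
          using that val_rel_mono[of R X] R(2,3) val_rel_sub[OF X _ valX[OF rr']] by blast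
      qed
      with x show ?thesis by (simp add: sub_plug)
    qed
  qed
qed

lemma simulates_strong_ut:
  assumes f: "f \<in> strong_uts" and X: "closed strong_uts X" and Y: "closed all_uts Y"
    and R: "simulates R S T" "R \<subseteq> S" "S \<subseteq> X" "T \<subseteq> Y" "X \<subseteq> Y"
  shows "simulates (f R) X Y"
proof -
  from Y have Y': "substitutive Y" "ut_substc Y \<subseteq> Y" "ut_red Y \<subseteq> Y"
    by (auto simp: closed_def substitutive_def)
  from X have X': "substitutive X" "ut_red X \<subseteq> X" by (auto simp: closed_def substitutive_def)
  have SY: "simulates R S Y" and XY: "simulates R X Y"
    using R(1,3,4) sim_pair_mono unfolding simulates_iff by blast+
  have "simulates (ut_refl R) X Y" by (rule simulates_refl[OF X'(1) Y'(1)])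
  moreover have "simulates (ut_abort R) X Y" by (rule simulates_abort) (use R in blast)
  moreover have "simulates (ut_lam R) X Y" by (rule simulates_lam[OF X'(2)]) (use R in blast)
  moreover have "simulates (ut_substv R) X Y" by (rule simulates_substv[OF X'(1) Y'(1,2) SY R(2,3,5)])
  moreover have "simulates (ut_red R) X Y" by (rule simulates_red[OF XY _ Y'(3)]) (use R in blast)
  ultimately show ?thesis using f simulates_result by auto
qed


section \<open>Diacritical compatibility\<close>

lemma mono_uts:
  assumes "f \<in> all_uts"
  shows "mono f"
proof -
  have "mono ut_refl" "mono ut_result" by (auto simp: mono_def ut_refl_def ut_result_def)
  moreover have "mono ut_abort" unfolding mono_def ut_abort_def by blast
  moreover have "mono ut_lam"
    unfolding mono_def ut_lam_def by (intro allI impI, drule trm_rel_mono) blast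
  moreover have "mono ut_substv"
    unfolding mono_def ut_substv_def by (intro allI impI, frule val_rel_mono) blast
  moreover have "mono ut_substc"
    unfolding mono_def ut_substc_def by (intro allI impI, frule ctx_rel_mono) blast
  moreover have "mono ut_red" unfolding mono_def ut_red_def by blast
  ultimately show ?thesis using assms by blast
qed

text \<open>Each technique treats both sides alike. This yields the symmetric half of progress from
  the one-sided simulation results.\<close>

lemma converse_uts:
  assumes "f \<in> all_uts"
  shows "f (R\<inverse>) = (f R)\<inverse>"
proof -
  have "ut_refl (R\<inverse>) = (ut_refl R)\<inverse>" unfolding ut_refl_def by blast
  moreover have "ut_result (R\<inverse>) = (ut_result R)\<inverse>" unfolding ut_result_def by blast
  moreover have "ut_abort (R\<inverse>) = (ut_abort R)\<inverse>" unfolding ut_abort_def by blast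
  moreover have "ut_lam (R\<inverse>) = (ut_lam R)\<inverse>" unfolding ut_lam_def trm_rel_converse by blast
  moreover have "ut_substv (R\<inverse>) = (ut_substv R)\<inverse>" unfolding ut_substv_def val_rel_converse by blast
  moreover have "ut_substc (R\<inverse>) = (ut_substc R)\<inverse>" unfolding ut_substc_def ctx_rel_converse by blast
  moreover have "ut_red (R\<inverse>) = (ut_red R)\<inverse>" unfolding ut_red_def by blast
  ultimately show ?thesis using assms by blast
qed

text \<open>Since some fresh name suffices, a single pair of \<open>R\<close> witnesses membership.
  The value and context extensions inherit this, and continuity of the techniques rests on
  it.\<close>

lemma trm_rel_finite: "x \<in> trm_rel R \<Longrightarrow> \<exists>S\<subseteq>R. finite S \<and> x \<in> trm_rel S"
proof -
  assume "x \<in> trm_rel R"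
  then obtain t s k where "x = (t, s)" "k \<notin> cv_trm t \<union> cv_trm s" and R: "(Nam k t, Nam k s) \<in> R"
    unfolding trm_rel_def by blast
  then have "x \<in> trm_rel {(Nam k t, Nam k s)}" unfolding trm_rel_def by blast
  with R show ?thesis by (intro exI[of _ "{(Nam k t, Nam k s)}"]) simp
qed

lemma val_rel_finite: "x \<in> val_rel R \<Longrightarrow> \<exists>S\<subseteq>R. finite S \<and> x \<in> val_rel S"
proof -
  assume "x \<in> val_rel R"
  then obtain v w y where x: "x = (v, w)" "y \<notin> fv_val v \<union> fv_val w"
    and R: "(App (Val v) (Val (Var y)), App (Val w) (Val (Var y))) \<in> trm_rel R"
    unfolding val_rel_def by blast
  from trm_rel_finite[OF R] obtain S where S: "S \<subseteq> R" "finite S"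
    "(App (Val v) (Val (Var y)), App (Val w) (Val (Var y))) \<in> trm_rel S"
    by meson
  then have "x \<in> val_rel S" using x unfolding val_rel_def by blast
  with S show ?thesis by meson
qed

lemma ctx_rel_finite: "x \<in> ctx_rel R \<Longrightarrow> \<exists>S\<subseteq>R. finite S \<and> x \<in> ctx_rel S"
proof -
  assume "x \<in> ctx_rel R"
  then obtain F F' y where "x = (F, F')" "y \<notin> fv_pctx F \<union> fv_pctx F'"
    and R: "(plug F (Val (Var y)), plug F' (Val (Var y))) \<in> R"
    unfolding ctx_rel_def by blast
  then have "x \<in> ctx_rel {(plug F (Val (Var y)), plug F' (Val (Var y)))}" unfolding ctx_rel_def by blast
  with R show ?thesis by (intro exI[of _ "{(plug F (Val (Var y)), plug F' (Val (Var y)))}"]) simp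
qed

lemma rel_continuous_iff:
  "rel_continuous f \<longleftrightarrow> (\<forall>R x. x \<in> f R \<longrightarrow> (\<exists>S\<subseteq>R. finite S \<and> x \<in> f S))"
proof -
  have "x \<in> \<Union> {f S | S. S \<subseteq> R \<and> finite S} \<longleftrightarrow> (\<exists>S\<subseteq>R. finite S \<and> x \<in> f S)" for R x
    by blast
  then show ?thesis unfolding rel_continuous_def subset_iff by simp
qed

lemma rel_continuousI:
  assumes "\<And>R x. x \<in> f R \<Longrightarrow> \<exists>S\<subseteq>R. finite S \<and> x \<in> f S"
  shows "rel_continuous f"
  by (simp add: rel_continuous_iff assms)

lemma continuous_uts:
  assumes "f \<in> all_uts"
  shows "rel_continuous f"
proof -
  have "rel_continuous ut_refl" by (rule rel_continuousI) (auto simp: ut_refl_def)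
  moreover have "rel_continuous ut_result" by (rule rel_continuousI) (auto simp: ut_result_def)
  moreover have "rel_continuous ut_abort"
  proof (rule rel_continuousI)
    fix R x assume "x \<in> ut_abort R"
    then obtain k p q where "x = (Nam k (Abort p), Nam k (Abort q))" and R: "(p, q) \<in> R"
      unfolding ut_abort_def by blast
    then have "x \<in> ut_abort {(p, q)}" unfolding ut_abort_def by blast
    with R show "\<exists>S\<subseteq>R. finite S \<and> x \<in> ut_abort S" by (intro exI[of _ "{(p, q)}"]) simp
  qed
  moreover have "rel_continuous ut_lam"
  proof (rule rel_continuousI)
    fix R x assume "x \<in> ut_lam R"
    then obtain k y t s where x: "x = (Nam k (Val (lambda y t)), Nam k (Val (lambda y s)))"
      and ts: "(t, s) \<in> trm_rel R"
      unfolding ut_lam_def by blast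
    from trm_rel_finite[OF ts] obtain S where "S \<subseteq> R" "finite S" "(t, s) \<in> trm_rel S" by meson
    moreover from this have "x \<in> ut_lam S" unfolding ut_lam_def x by blast
    ultimately show "\<exists>S\<subseteq>R. finite S \<and> x \<in> ut_lam S" by meson
  qed
  moreover have "rel_continuous ut_substv"
  proof (rule rel_continuousI)
    fix R x assume "x \<in> ut_substv R"
    then obtain y v w p q where x: "x = (substv_prog y v p, substv_prog y w q)"
      and pq: "(p, q) \<in> R" and vw: "(v, w) \<in> val_rel R"
      unfolding ut_substv_def by blast
    from val_rel_finite[OF vw] obtain S where S: "S \<subseteq> R" "finite S" "(v, w) \<in> val_rel S" by meson
    have "(v, w) \<in> val_rel (insert (p, q) S)" using S(3) val_rel_mono[of S "insert (p, q) S"] by blast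
    then have "x \<in> ut_substv (insert (p, q) S)" unfolding ut_substv_def x by blast
    with S pq show "\<exists>S\<subseteq>R. finite S \<and> x \<in> ut_substv S" by (intro exI[of _ "insert (p, q) S"]) simp
  qed
  moreover have "rel_continuous ut_substc"
  proof (rule rel_continuousI)
    fix R x assume "x \<in> ut_substc R"
    then obtain k F F' p q where x: "x = (substc_prog k F p, substc_prog k F' q)"
      and pq: "(p, q) \<in> R" and FF': "(F, F') \<in> ctx_rel R"
      unfolding ut_substc_def by blast
    from ctx_rel_finite[OF FF'] obtain S where S: "S \<subseteq> R" "finite S" "(F, F') \<in> ctx_rel S" by meson
    have "(F, F') \<in> ctx_rel (insert (p, q) S)" using S(3) ctx_rel_mono[of S "insert (p, q) S"] by blast
    then have "x \<in> ut_substc (insert (p, q) S)" unfolding ut_substc_def x by blast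
    with S pq show "\<exists>S\<subseteq>R. finite S \<and> x \<in> ut_substc S" by (intro exI[of _ "insert (p, q) S"]) simp
  qed
  moreover have "rel_continuous ut_red"
  proof (rule rel_continuousI)
    fix R x assume "x \<in> ut_red R"
    then obtain p q p' q' where "x = (p, q)" "p \<longmapsto>* p'" "q \<longmapsto>* q'" and R: "(p', q') \<in> R"
      unfolding ut_red_def by blast
    then have "x \<in> ut_red {(p', q')}" unfolding ut_red_def by blast
    with R show "\<exists>S\<subseteq>R. finite S \<and> x \<in> ut_red S" by (intro exI[of _ "{(p', q')}"]) simp
  qed
  ultimately show ?thesis using assms by blast
qed

lemma closed_converse:
  assumes "closed G X" "G \<subseteq> all_uts"
  shows "closed G (X\<inverse>)"
  unfolding closed_def
proof
  fix g assume g: "g \<in> G"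
  with assms(2) have "g (X\<inverse>) = (g X)\<inverse>" by (intro converse_uts) blast
  with assms(1) g show "g (X\<inverse>) \<subseteq> X\<inverse>" by (simp add: closed_def converse_mono)
qed

section \<open>Closures obtained by iteration\<close>

lemma hat_apply: "hat (Sup G) R = (\<Union>g\<in>G. g R) \<union> R"
  by (simp add: hat_def)

lemma omega_apply: "omega f R = (\<Union>n. (f ^^ n) R)"
  by (simp add: omega_def)

lemma omega_increasing: "R \<subseteq> omega f R"
  unfolding omega_apply using funpow_0[of f R] by blast

lemma omega_least:
  assumes "closed G Y" "\<And>g. g \<in> G \<Longrightarrow> mono g" "R \<subseteq> Y"
  shows "omega (hat (Sup G)) R \<subseteq> Y"
proof -
  have "(hat (Sup G) ^^ n) R \<subseteq> Y" for n
  proof (induction n)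
    case (Suc n)
    have "g ((hat (Sup G) ^^ n) R) \<subseteq> Y" if "g \<in> G" for g
      using monoD[OF assms(2)[OF that] Suc] assms(1) that unfolding closed_def by blast
    with Suc show ?case unfolding funpow.simps o_apply hat_apply by blast
  qed (simp add: assms(3))
  then show ?thesis by (auto simp: omega_apply)
qed

lemma finite_subset_chain:
  fixes C :: "nat \<Rightarrow> 'a set"
  assumes "finite S" "S \<subseteq> (\<Union>n. C n)" "mono C"
  shows "\<exists>n. S \<subseteq> C n"
  using assms(1,2)
proof (induction S)
  case (insert x S)
  then obtain m n where "S \<subseteq> C m" "x \<in> C n" by auto
  moreover have "C m \<subseteq> C (max m n)" "C n \<subseteq> C (max m n)" by (simp_all add: monoD[OF assms(3)])
  ultimately have "insert x S \<subseteq> C (max m n)" by blast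
  then show ?case ..
qed simp

text \<open>By continuity an element of \<open>g\<close> at the limit needs only finitely many
  pairs. The stages increase because \<open>hat\<close> includes the identity, so one stage holds
  them all and the next one contains the element.\<close>

lemma closed_omega:
  assumes "\<And>g. g \<in> G \<Longrightarrow> mono g" "\<And>g. g \<in> G \<Longrightarrow> rel_continuous g"
  shows "closed G (omega (hat (Sup G)) R)"
  unfolding closed_def
proof (intro ballI subsetI)
  let ?C = "\<lambda>n. (hat (Sup G) ^^ n) R"
  fix g x assume g: "g \<in> G" and x: "x \<in> g (omega (hat (Sup G)) R)"
  from assms(2)[OF g] x obtain S where S: "S \<subseteq> omega (hat (Sup G)) R" "finite S" "x \<in> g S"
    unfolding rel_continuous_iff by meson
  have "mono ?C" unfolding mono_iff_le_Suc funpow.simps o_apply hat_apply by blast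
  from finite_subset_chain[OF S(2) S(1)[unfolded omega_apply] this]
  obtain n where "S \<subseteq> ?C n" by blast
  with monoD[OF assms(1)[OF g]] S(3) have "x \<in> g (?C n)" by blast
  with g have "x \<in> ?C (Suc n)" unfolding funpow.simps o_apply hat_apply by blast
  then show "x \<in> omega (hat (Sup G)) R" unfolding omega_apply by blast
qed

lemma closed_subset: "closed G X \<Longrightarrow> H \<subseteq> G \<Longrightarrow> closed H X"
  by (auto simp: closed_def)

lemma closed_omega_uts: "G \<subseteq> all_uts \<Longrightarrow> closed G (omega (hat (Sup G)) R)"
  by (rule closed_omega) (use mono_uts continuous_uts in blast)+

section \<open>Progress of the techniques and the strong subset\<close>

lemma progress_strong_ut:
  assumes f: "f \<in> strong_uts" and X: "closed strong_uts X" and Y: "closed all_uts Y"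
    and R: "progress R S T" "S \<subseteq> X" "T \<subseteq> Y" "X \<subseteq> Y"
  shows "progress (f R) X Y"
  unfolding progress_def
proof (intro conjI)
  from f have fa: "f \<in> all_uts" by blast
  from R(1) have RS: "R \<subseteq> S" "simulates R S T" "simulates (R\<inverse>) (S\<inverse>) (T\<inverse>)"
    by (simp_all add: progress_def)
  have "f R \<subseteq> f X" using monoD[OF mono_uts[OF fa]] RS(1) R(2) by blast
  also have "f X \<subseteq> X" using X f unfolding closed_def by blast
  finally show "f R \<subseteq> X" .
  show "X \<subseteq> Y" by fact
  show "simulates (f R) X Y"
    by (rule simulates_strong_ut[OF f X Y RS(2,1) R(2-4)])
  have "simulates (f (R\<inverse>)) (X\<inverse>) (Y\<inverse>)"
    by (rule simulates_strong_ut[OF f closed_converse[OF X] closed_converse[OF Y] RS(3)])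
      (use RS(1) R(2-4) in auto)
  then show "simulates ((f R)\<inverse>) (X\<inverse>) (Y\<inverse>)" by (simp add: converse_uts[OF fa])
qed

lemma progress_substc:
  assumes X0: "closed strong_uts X0" and X: "closed strong_uts X" and Y: "closed all_uts Y"
    and R: "progress R R T" "R \<subseteq> X0" "X0 \<subseteq> X" "ut_substc X0 \<subseteq> X" "T \<subseteq> Y" "X \<subseteq> Y"
  shows "progress (ut_substc R) X Y"
  unfolding progress_def
proof (intro conjI)
  have fa: "ut_substc \<in> all_uts" by blast
  have sim: "simulates (ut_substc R) X Y"
    if "closed strong_uts X0" "closed strong_uts X" "closed all_uts Y" "simulates R R T"
      "R \<subseteq> X0" "X0 \<subseteq> X" "ut_substc X0 \<subseteq> X" "T \<subseteq> Y" "X \<subseteq> Y" for R X0 X T Y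
  proof -
    have "substitutive Y" "ut_substc Y \<subseteq> Y" using that(3) by (auto simp: closed_def substitutive_def)
    moreover have "simulates R R Y" using that(4,8) sim_pair_mono[of R T _ _ R Y] unfolding simulates_iff by blast
    ultimately show ?thesis
      using simulates_substc[OF closed_substitutive[OF that(1)] closed_substitutive[OF that(2)]] that by blast
  qed
  show "ut_substc R \<subseteq> X" using monoD[OF mono_uts[OF fa] R(2)] R(4) by blast
  show "X \<subseteq> Y" by fact
  show "simulates (ut_substc R) X Y"
    by (rule sim[OF X0 X Y _ R(2-6)]) (use R(1) in \<open>simp add: progress_def\<close>)
  have "simulates (ut_substc (R\<inverse>)) (X\<inverse>) (Y\<inverse>)"
  proof (rule sim[OF closed_converse[OF X0] closed_converse[OF X] closed_converse[OF Y]])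
    show "simulates (R\<inverse>) (R\<inverse>) (T\<inverse>)" using R(1) by (simp add: progress_def)
    show "ut_substc (X0\<inverse>) \<subseteq> X\<inverse>" using R(4) by (simp add: converse_uts[OF fa] converse_mono)
  qed (use R in auto)
  then show "simulates ((ut_substc R)\<inverse>) (X\<inverse>) (Y\<inverse>)" by (simp add: converse_uts[OF fa])
qed

lemma strong_subset_strong_uts: "strong_subset all_uts strong_uts"
  unfolding strong_subset_def
proof (intro conjI ballI)
  let ?s = "omega (hat (Sup strong_uts))" and ?a = "omega (hat (Sup all_uts))"
  have s: "closed strong_uts (?s R)" and a: "closed all_uts (?a R)" for R
    by (rule closed_omega_uts; blast)+
  have a': "closed strong_uts (?a R)" for R by (rule closed_subset[OF a]) blast
  \<comment> \<open>The full closure is also closed under the strong techniques, so applying the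
    strong closure inside it does not leave it.\<close>
  have least: "?s R \<subseteq> ?a T" if "R \<subseteq> ?a T" for R T
    by (rule omega_least[OF a' _ that]) (use mono_uts in blast)
  show "strong_uts \<subseteq> all_uts" by blast
  show "strongly_evolves f ?s ?a" if f: "f \<in> strong_uts" for f
    unfolding strongly_evolves_def
  proof (intro allI impI)
    fix R S T assume p: "progress R S T"
    then have "S \<subseteq> ?a T" using omega_increasing[of T] unfolding progress_def by blast
    from least[OF this] have "?s S \<subseteq> ?a T" .
    then show "progress (f R) (?s S) (?a T)"
      by (rule progress_strong_ut[OF f s a p omega_increasing omega_increasing])
  qed
  show "evolves f (?s \<circ> hat (Sup all_uts) \<circ> ?s) ?a" if f: "f \<in> all_uts" for f
    unfolding evolves_def o_apply
  proof (intro allI impI)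
    fix R T assume p: "progress R R T"
    \<comment> \<open>The layers of the prescribed passive target: strong techniques, then at most
      one use of any technique including \<open>ut_substc\<close>, then strong techniques again.
      \<open>?B\<close> and \<open>?D\<close> are the two closures required by
      \<open>progress_substc\<close>.\<close>
    let ?B = "?s R" and ?C = "hat (Sup all_uts) (?s R)" and ?D = "?s (hat (Sup all_uts) (?s R))"
    have "R \<subseteq> ?a T" using p omega_increasing[of T] unfolding progress_def by blast
    from least[OF this] have X0: "?B \<subseteq> ?a T" .
    have "g ?B \<subseteq> ?a T" if "g \<in> all_uts" for g
      using monoD[OF mono_uts[OF that] X0] a that unfolding closed_def by blast
    with X0 have X1: "?C \<subseteq> ?a T" unfolding hat_apply by blast
    have X: "?D \<subseteq> ?a T" by (rule least[OF X1])
    have X01: "?B \<subseteq> ?D" "ut_substc ?B \<subseteq> ?D"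
      using omega_increasing[of ?C "hat (Sup strong_uts)"] unfolding hat_apply[of all_uts] by blast+
    show "progress (f R) ?D (?a T)"
    proof (cases "f \<in> strong_uts")
      case True
      show ?thesis
        by (rule progress_strong_ut[OF True s a p _ omega_increasing X])
          (rule order_trans[OF omega_increasing X01(1)])
    next
      case False
      with f have f: "f = ut_substc" by blast
      show ?thesis
        unfolding f by (rule progress_substc[OF s s a p omega_increasing X01 omega_increasing X])
    qed
  qed
qed

text \<open>A counterexample: \<open>k a\<close> and \<open>k b\<close>, for distinct variables \<open>a\<close> and \<open>b\<close>, progress as soon
  as \<open>k (a y)\<close> and \<open>k (b y)\<close> are passively related, but the context \<open>[] y\<close> substituted for
  \<open>k\<close> exposes the different head variables.\<close>

lemma substc_not_strongly_evolves: "\<not> strongly_evolves ut_substc g h"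
proof
  assume ev: "strongly_evolves ut_substc g h"
  \<comment> \<open>Variable 2 is the argument; it differs from the two heads 0 and 1, so it is
    fresh for both.\<close>
  define st where "st x = App (Val (Var x)) (Val (Var 2))" for x
  define F where "F = PlainC (FunC Hole (Val (Var 2)))"
  \<comment> \<open>The first pair relates \<open>F\<close> to itself, with 0 as the fresh variable
    in the hole; the second is the pair into which \<open>F\<close> gets plugged.\<close>
  define R where "R a b = {(Trm (st 0), Trm (st 0)), (Nam 0 (Val (Var a)), Nam 0 (Val (Var b)))}" for a b
  \<comment> \<open>The added pair is exactly what relates the values \<open>a\<close> and
    \<open>b\<close> passively. It belongs to \<open>S\<close> only, so it need not
    progress.\<close>
  define S where "S a b = insert (Nam 0 (st a), Nam 0 (st b)) (R a b)" for a b
  have UNIV: "substitutive UNIV" by (simp add: substitutive_def)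
  \<comment> \<open>Stated for arbitrary heads below 2, so that exchanging 0 and 1 provides the
    converse simulation.\<close>
  have sim: "simulates (R a b) (S a b) UNIV" if "a < 2" "b < 2" for a b
  proof -
    have "(Var a, Var b) \<in> val_rel (S a b)"
      using that unfolding val_rel_iff S_def st_def by (intro exI[of _ 2] exI[of _ 0]) simp
    then have "sim_pair (S a b) UNIV (Nam 0 (Val (Var a))) (Nam 0 (Val (Var b)))"
      by (rule sim_pair_namedI[OF rtranclp.rtrancl_refl])
    moreover have "sim_pair (S a b) UNIV (Trm (st 0)) (Trm (st 0))"
      using sim_pair_stuckI[OF rtranclp.rtrancl_refl ctx_rel_refl[OF UNIV] val_rel_refl[OF UNIV],
          of "S a b" "PlainC Hole" 0 "Var 2"] by (simp add: st_def)
    ultimately show ?thesis unfolding simulates_iff R_def by blast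
  qed
  have "(R 0 1)\<inverse> = R 1 0" "(S 0 1)\<inverse> = S 1 0" by (auto simp: R_def S_def)
  then have "progress (R 0 1) (S 0 1) UNIV"
    using sim[of 0 1] sim[of 1 0] unfolding progress_def by (auto simp: S_def)
  with ev have "simulates (ut_substc (R 0 1)) (g (S 0 1)) (h UNIV)"
    unfolding strongly_evolves_def progress_def by blast
  moreover have "(Trm (st 0), Trm (st 1)) \<in> ut_substc (R 0 1)"
  proof -
    have "(F, F) \<in> ctx_rel (R 0 1)"
      unfolding ctx_rel_def by (auto intro!: exI[of _ 0] simp: F_def R_def st_def)
    moreover have "(Nam 0 (Val (Var 0)), Nam 0 (Val (Var 1))) \<in> R 0 1" by (simp add: R_def)
    ultimately have "(substc_prog 0 F (Nam 0 (Val (Var 0))), substc_prog 0 F (Nam 0 (Val (Var 1)))) \<in> ut_substc (R 0 1)"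
      unfolding ut_substc_def by blast
    then show ?thesis by (simp add: F_def st_def)
  qed
  ultimately have "sim_pair (g (S 0 1)) (h UNIV) (Trm (st 0)) (Trm (st 1))" by (simp add: simulates_iff)
  moreover have st: "Trm (st x) = plug (PlainC Hole) (App (Val (Var x)) (Val (Var 2)))" for x
    by (simp add: st_def)
  ultimately obtain F' w where "Trm (st 1) \<longmapsto>* plug F' (App (Val (Var 0)) (Val w))"
    unfolding st by (blast elim: sim_pair_stuckE)
  \<comment> \<open>The right program is stuck, so its reduction is empty; unique decomposition
    would then identify the heads 1 and 0.\<close>
  then have "plug (PlainC Hole) (App (Val (Var 1)) (Val (Var 2))) = plug F' (App (Val (Var 0)) (Val w))"
    unfolding st by (cases rule: converse_rtranclpE) (auto simp del: plug.simps simp: stuck_no_step)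
  from plug_inj[OF _ _ this] show False by simp
qed

theorem theorem5p8:
  shows "diacritically_compatible
           {ut_refl, ut_result, ut_abort, ut_lam, ut_substv, ut_substc, ut_red}
       \<and> strong {ut_refl, ut_result, ut_abort, ut_lam, ut_substv, ut_substc, ut_red}
         = {ut_refl, ut_result, ut_abort, ut_lam, ut_substv, ut_substc, ut_red} - {ut_substc}"
proof
  show "diacritically_compatible all_uts"
    unfolding diacritically_compatible_def using continuous_uts strong_subset_strong_uts by blast
  \<comment> \<open>The counterexample defeats every choice of targets, so it applies whatever the
    candidate strong subset is.\<close>
  have not: "ut_substc \<notin> \<S>" if "strong_subset all_uts \<S>" for \<S>
    using that substc_not_strongly_evolves unfolding strong_subset_def by blast
  from not[OF strong_subset_strong_uts] have "all_uts - {ut_substc} = strong_uts" by blast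
  moreover have "strong_uts \<subseteq> strong all_uts"
    unfolding strong_def using strong_subset_strong_uts by blast
  moreover have "strong all_uts \<subseteq> all_uts - {ut_substc}"
    unfolding strong_def using not unfolding strong_subset_def by blast
  ultimately show "strong all_uts = all_uts - {ut_substc}" by blast
qed

end
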